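(* There is a deterministic (polynomial time) online fractional algorithm that maintains the condition that for every request time $t$, there exists an index $j \in [\ell]$ such that there is unit server mass of weight $W_j$ at location $\sigma_t$ at time $t$. The algorithm uses $2\ell k_j$ servers of weight $W_j$ for each $j \in [\ell]$, and its cost is at most $O(\ell^2 \log \ell)$ times that of an optimal fractional solution.
   Context: Weighted $k$-server problem on the uniform metric: $n$ points $V$ with all pairwise distances $1$; there are $\ell$ distinct server weights $W_1,\dots,W_\ell$ with $k_j$ servers of weight $W_j$; requests $\sigma_1,\dots,\sigma_T \in V$ arrive online, and moving a server of weight $W_j$ between distinct points costs $W_j$. A fractional solution specifies $x_{v,j,t}\ge 0$, the fractional mass of servers of weight $W_j$ at location $v$ at time $t$; the natural LP relaxation minimizes $\tfrac12\sum_{j} W_j \sum_t \sum_{v} |x_{v,j,t}-x_{v,j,t-1}|$ subject to $\sum_{v} x_{v,j,t}\le k_j$ for all $t,j$ and $\sum_j x_{\sigma_t,j,t}\ge 1$ for all $t$. An optimal fractional solution is an optimal solution to this LP (with the original server counts $k_j$). Note the condition in the claim (a single weight class supplying a full unit of mass at $\sigma_t$) is stronger than the LP covering constraint $\sum_j x_{\sigma_t,j,t}\ge 1$. *)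

theory Defs
  imports Complex_Main "HOL-Library.Landau_Symbols"
begin

section \<open>Weighted \<open>k\<close>-server on the uniform metric\<close>

text \<open>
  Points are \<open>0, \<dots>, num_points - 1\<close> and weight classes are \<open>0, \<dots>, num_weights - 1\<close>;
  \<open>init v j\<close> is the number of servers of weight class \<open>j\<close> standing at point \<open>v\<close> before the
  first request. Servers that are not placed by \<open>init\<close> start outside of the space; in
  particular \<open>init\<close> may be identically zero.
\<close>

record server_instance =
  num_points :: nat
  num_weights :: nat
  servers :: "nat \<Rightarrow> nat"
  weight :: "nat \<Rightarrow> real"
  init :: "nat \<Rightarrow> nat \<Rightarrow> nat"

definition valid_instance :: "server_instance \<Rightarrow> bool" where
  "valid_instance I \<longleftrightarrow>
     num_points I \<ge> 1 \<and> num_weights I \<ge> 1 \<and>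
     (\<forall>j<num_weights I. weight I j > 0) \<and>
     inj_on (weight I) {..<num_weights I} \<and>
     (\<forall>j<num_weights I. servers I j \<ge> 1) \<and>
     (\<forall>j<num_weights I. (\<Sum>v<num_points I. init I v j) \<le> servers I j)"

definition valid_requests :: "server_instance \<Rightarrow> nat list \<Rightarrow> bool" where
  "valid_requests I \<sigma> \<longleftrightarrow> set \<sigma> \<subseteq> {..<num_points I}"

text \<open>
  A fractional solution is a function \<open>x\<close> where \<open>x v j t\<close> is the mass of servers of weight
  class \<open>j\<close> at point \<open>v\<close> at time \<open>t\<close>. Times range over \<open>0, \<dots>, T\<close>, time \<open>0\<close> being the
  initial configuration; the request of time \<open>t \<ge> 1\<close> is \<open>\<sigma> ! (t - 1)\<close>.
\<close>

definition fractional_solution ::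
    "server_instance \<Rightarrow> (nat \<Rightarrow> nat) \<Rightarrow> nat \<Rightarrow> (nat \<Rightarrow> nat \<Rightarrow> nat \<Rightarrow> real) \<Rightarrow> bool" where
  "fractional_solution I cap T x \<longleftrightarrow>
     (\<forall>v<num_points I. \<forall>j<num_weights I. x v j 0 = real (init I v j)) \<and>
     (\<forall>v<num_points I. \<forall>j<num_weights I. \<forall>t\<le>T. x v j t \<ge> 0) \<and>
     (\<forall>j<num_weights I. \<forall>t\<le>T. (\<Sum>v<num_points I. x v j t) \<le> real (cap j))"

definition movement_cost ::
    "server_instance \<Rightarrow> nat \<Rightarrow> (nat \<Rightarrow> nat \<Rightarrow> nat \<Rightarrow> real) \<Rightarrow> real" where
  "movement_cost I T x =
     1/2 * (\<Sum>j<num_weights I. weight I j *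
              (\<Sum>t=1..T. \<Sum>v<num_points I. \<bar>x v j t - x v j (t - 1)\<bar>))"

definition lp_feasible ::
    "server_instance \<Rightarrow> nat list \<Rightarrow> (nat \<Rightarrow> nat \<Rightarrow> nat \<Rightarrow> real) \<Rightarrow> bool" where
  "lp_feasible I \<sigma> x \<longleftrightarrow>
     fractional_solution I (servers I) (length \<sigma>) x \<and>
     (\<forall>t\<in>{1..length \<sigma>}. (\<Sum>j<num_weights I. x (\<sigma> ! (t - 1)) j t) \<ge> 1)"

definition lp_opt :: "server_instance \<Rightarrow> nat list \<Rightarrow> real" where
  "lp_opt I \<sigma> = Inf (movement_cost I (length \<sigma>) ` {x. lp_feasible I \<sigma> x})"

text \<open>
  A deterministic online fractional algorithm maps an instance and the requests seen so far to
  the current configuration; \<open>trajectory A I \<sigma>\<close> is the fractional solution it produces.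
\<close>

type_synonym online_alg = "server_instance \<Rightarrow> nat list \<Rightarrow> nat \<Rightarrow> nat \<Rightarrow> real"

definition trajectory ::
    "online_alg \<Rightarrow> server_instance \<Rightarrow> nat list \<Rightarrow> nat \<Rightarrow> nat \<Rightarrow> nat \<Rightarrow> real" where
  "trajectory A I \<sigma> v j t = A I (take t \<sigma>) v j"

definition single_weight_service ::
    "server_instance \<Rightarrow> nat list \<Rightarrow> (nat \<Rightarrow> nat \<Rightarrow> nat \<Rightarrow> real) \<Rightarrow> bool" where
  "single_weight_service I \<sigma> x \<longleftrightarrow>
     (\<forall>t\<in>{1..length \<sigma>}. \<exists>j<num_weights I. x (\<sigma> ! (t - 1)) j t \<ge> 1)"


section \<open>Polynomial time\<close>

text \<open>
  Weights are real numbers, so the machine model is a real RAM (uniform, unit cost): programs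
  act on arrays of natural numbers and arrays of reals with indirect addressing. There is no
  rounding operation, indices admit only addition and truncated subtraction, and the only
  constants are integers, so that real constants cannot carry precomputed information.
  An expression is evaluated in one step, which is harmless because the expressions of a fixed
  program have bounded size.
\<close>

type_synonym ram_state = "(nat \<Rightarrow> nat \<Rightarrow> nat) \<times> (nat \<Rightarrow> nat \<Rightarrow> real)"

datatype nexp =
    NConst nat
  | NCell nat nexp
  | NAdd nexp nexp
  | NSub nexp nexp

datatype rexp =
    RConst int
  | RNat nexp
  | RCell nat nexp
  | RAdd rexp rexp
  | RSub rexp rexp
  | RMul rexp rexp
  | RDiv rexp rexp

datatype bexp =
    NLess nexp nexp
  | RLess rexp rexp
  | BNot bexp
  | BAnd bexp bexp

datatype com =
    Skip
  | NAssign nat nexp nexp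
  | RAssign nat nexp rexp
  | Seq com com
  | Cond bexp com com
  | While bexp com

primrec nval :: "nexp \<Rightarrow> ram_state \<Rightarrow> nat" where
  "nval (NConst c) s = c"
| "nval (NCell a e) s = fst s a (nval e s)"
| "nval (NAdd e f) s = nval e s + nval f s"
| "nval (NSub e f) s = nval e s - nval f s"

primrec rval :: "rexp \<Rightarrow> ram_state \<Rightarrow> real" where
  "rval (RConst c) s = of_int c"
| "rval (RNat e) s = real (nval e s)"
| "rval (RCell a e) s = snd s a (nval e s)"
| "rval (RAdd e f) s = rval e s + rval f s"
| "rval (RSub e f) s = rval e s - rval f s"
| "rval (RMul e f) s = rval e s * rval f s"
| "rval (RDiv e f) s = rval e s / rval f s"

primrec bval :: "bexp \<Rightarrow> ram_state \<Rightarrow> bool" where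
  "bval (NLess e f) s \<longleftrightarrow> nval e s < nval f s"
| "bval (RLess e f) s \<longleftrightarrow> rval e s < rval f s"
| "bval (BNot b) s \<longleftrightarrow> \<not> bval b s"
| "bval (BAnd b c) s \<longleftrightarrow> bval b s \<and> bval c s"

definition upd :: "(nat \<Rightarrow> nat \<Rightarrow> 'a) \<Rightarrow> nat \<Rightarrow> nat \<Rightarrow> 'a \<Rightarrow> nat \<Rightarrow> nat \<Rightarrow> 'a" where
  "upd m a i y = m(a := (m a)(i := y))"

text \<open>\<open>runs c s t s'\<close>: started in \<open>s\<close>, program \<open>c\<close> halts in \<open>s'\<close> after \<open>t\<close> steps.\<close>

inductive runs :: "com \<Rightarrow> ram_state \<Rightarrow> nat \<Rightarrow> ram_state \<Rightarrow> bool" where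
  Skip: "runs Skip s 1 s"
| NAssign: "runs (NAssign a i e) s 1 (upd (fst s) a (nval i s) (nval e s), snd s)"
| RAssign: "runs (RAssign a i e) s 1 (fst s, upd (snd s) a (nval i s) (rval e s))"
| Seq: "runs c1 s1 t1 s2 \<Longrightarrow> runs c2 s2 t2 s3 \<Longrightarrow> runs (Seq c1 c2) s1 (t1 + t2) s3"
| CondTrue: "bval b s \<Longrightarrow> runs c1 s t s' \<Longrightarrow> runs (Cond b c1 c2) s (t + 1) s'"
| CondFalse: "\<not> bval b s \<Longrightarrow> runs c2 s t s' \<Longrightarrow> runs (Cond b c1 c2) s (t + 1) s'"
| WhileFalse: "\<not> bval b s \<Longrightarrow> runs (While b c) s 1 s"
| WhileTrue: "bval b s1 \<Longrightarrow> runs c s1 t1 s2 \<Longrightarrow> runs (While b c) s2 t2 s3 \<Longrightarrow>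
    runs (While b c) s1 (t1 + t2 + 1) s3"

text \<open>
  Input layout: natural number array 0 holds the number of points, of weights and of requests,
  array 1 the requests, array 2 the server counts and array 3 the initial configuration
  (row-major, entry \<open>(v, j)\<close> at \<open>v * num_weights + j\<close>); real array 0 holds the weights. All
  other cells are 0.
\<close>

definition input_state :: "server_instance \<Rightarrow> nat list \<Rightarrow> ram_state" where
  "input_state I \<sigma> =
    ((\<lambda>a i.
        if a = 0 \<and> i = 0 then num_points I
        else if a = 0 \<and> i = 1 then num_weights I
        else if a = 0 \<and> i = 2 then length \<sigma>
        else if a = 1 \<and> i < length \<sigma> then \<sigma> ! i
        else if a = 2 \<and> i < num_weights I then servers I i
        else if a = 3 \<and> i < num_points I * num_weights I
          then init I (i div num_weights I) (i mod num_weights I)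
        else 0),
     (\<lambda>a i. if a = 0 \<and> i < num_weights I then weight I i else 0))"

definition ram_output :: "server_instance \<Rightarrow> ram_state \<Rightarrow> nat \<Rightarrow> nat \<Rightarrow> real" where
  "ram_output I s v j = snd s 1 (v * num_weights I + j)"

text \<open>
  One program, for all instances, computes the configuration after the requests \<open>\<sigma>\<close>. Since the
  machine recomputes from the whole prefix, no state has to be carried over between requests;
  processing \<open>T\<close> requests costs the sum of the bounds for the \<open>T\<close> prefixes.
\<close>

definition polynomial_time :: "online_alg \<Rightarrow> bool" where
  "polynomial_time A \<longleftrightarrow>
     (\<exists>c d. \<forall>I \<sigma>. valid_instance I \<longrightarrow> valid_requests I \<sigma> \<longrightarrow>
        (\<exists>t s. runs c (input_state I \<sigma>) t s \<and>
               t \<le> d * (num_points I + num_weights I + length \<sigma>) ^ d \<and>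
               (\<forall>v<num_points I. \<forall>j<num_weights I. A I \<sigma> v j = ram_output I s v j)))"

end

theory Submission
  imports Defs "HOL-Real_Asymp.Real_Asymp"
begin

text \<open>
  A request \<open>r\<close> raises all classes at \<open>r\<close> at rates inversely proportional to their weights until
  one of them reaches a unit of mass, so that every class pays the same amount \<open>s\<close>. A class whose
  total mass then exceeds \<open>2 l k\<^sub>j\<close> is scaled down proportionally at all other points.
  Against a feasible fractional solution \<open>y\<close> consider the potential
  \<open>\<Sum>\<^sub>j W\<^sub>j \<Sum>\<^sub>v y\<^sub>v\<^sub>j max 0 (1 - x\<^sub>v\<^sub>j)\<close>. Raising lowers it by \<open>s \<Sum>\<^sub>j y\<^sub>r\<^sub>j \<ge> s\<close>. Scaling class \<open>j\<close>
  removes at most \<open>s / W\<^sub>j\<close> out of at least \<open>2 l k\<^sub>j - 1\<close> units of mass, and \<open>y\<close> has at most \<open>k\<^sub>j\<close>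
  units in this class, so all classes together raise the potential by at most \<open>2 s / 3\<close>. The
  algorithm moves at cost at most \<open>l s\<close>, while a move of \<open>y\<close> raises the potential by at most twice
  its cost. This gives the ratio \<open>6 l\<close>, which is better than \<open>l\<^sup>2 ln l\<close>.
\<close>

section \<open>Depositing mass at a point under a capacity\<close>

definition shrink_factor :: "real \<Rightarrow> real \<Rightarrow> real" where
  "shrink_factor R M = (if R < M then R / M else 1)"

lemma shrink_factor_nonneg: "0 \<le> R \<Longrightarrow> 0 \<le> shrink_factor R M"
  by (simp add: shrink_factor_def)

lemma shrink_factor_le_1: "0 \<le> R \<Longrightarrow> shrink_factor R M \<le> 1"
  by (simp add: shrink_factor_def)

lemma mult_shrink_factor: "0 \<le> R \<Longrightarrow> M * shrink_factor R M = min R M"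
  by (simp add: shrink_factor_def)

definition deposit :: "'a set \<Rightarrow> real \<Rightarrow> 'a \<Rightarrow> real \<Rightarrow> ('a \<Rightarrow> real) \<Rightarrow> 'a \<Rightarrow> real" where
  "deposit V K r a c v =
     (if v = r then c r + a
      else c v * shrink_factor (K - (c r + a)) (\<Sum>u\<in>V - {r}. c u))"

definition gap :: "real \<Rightarrow> real" where
  "gap a = max 0 (1 - a)"

lemma gap_nonneg: "0 \<le> gap a"
  by (simp add: gap_def)

lemma gap_le_1: "0 \<le> a \<Longrightarrow> gap a \<le> 1"
  by (simp add: gap_def)

lemma gap_mult_le:
  assumes "0 \<le> a" "0 \<le> f" "f \<le> 1"
  shows "gap (a * f) \<le> gap a + (1 - f)"
proof (cases "a \<le> 1")
  case True
  then have "a * (1 - f) \<le> 1 * (1 - f)"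
    using assms by (intro mult_right_mono) auto
  then show ?thesis
    using True assms by (simp add: gap_def algebra_simps)
next
  case False
  then have "1 * f \<le> a * f"
    using assms by (intro mult_right_mono) auto
  then show ?thesis
    using False assms by (simp add: gap_def)
qed

locale unit_deposit =
  fixes V :: "'a set" and K :: real and r :: 'a and a :: real and c :: "'a \<Rightarrow> real"
  assumes finite_points: "finite V" and target: "r \<in> V"
    and mass_nonneg: "\<And>v. v \<in> V \<Longrightarrow> 0 \<le> c v"
    and mass_le_capacity: "sum c V \<le> K" and capacity_gt_1: "1 < K"
    and amount_nonneg: "0 \<le> a"
    and raised_le: "c r + a \<le> max 1 (c r)" \<comment> \<open>that is, \<open>a = 0\<close> or \<open>c r + a \<le> 1\<close>\<close>
begin

definition room :: real where
  "room = K - (c r + a)"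

definition other_mass :: real where
  "other_mass = (\<Sum>v\<in>V - {r}. c v)"

definition evicted :: real where
  "evicted = 1 - shrink_factor room other_mass"

lemma sum_split: "sum g V = g r + (\<Sum>v\<in>V - {r}. g v)" for g :: "'a \<Rightarrow> real"
  using finite_points target by (rule sum.remove)

lemma deposit_at: "deposit V K r a c r = c r + a"
  by (simp add: deposit_def)

lemma deposit_off: "v \<noteq> r \<Longrightarrow> deposit V K r a c v = c v * (1 - evicted)"
  by (simp add: deposit_def evicted_def room_def other_mass_def)

lemma room_nonneg: "0 \<le> room"
proof -
  have "c r \<le> K"
    using member_le_sum[OF target _ finite_points, of c] mass_nonneg mass_le_capacity by auto
  then show ?thesis
    using raised_le capacity_gt_1 by (simp add: room_def)
qed

lemma evicted_nonneg: "0 \<le> evicted" and evicted_le_1: "evicted \<le> 1"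
  using shrink_factor_nonneg shrink_factor_le_1 room_nonneg by (auto simp: evicted_def)

lemma other_mass_evicted: "other_mass * (1 - evicted) = min room other_mass"
  using mult_shrink_factor[OF room_nonneg] by (simp add: evicted_def)

lemma other_mass_mult_evicted_le: "other_mass * evicted \<le> a"
proof -
  have "other_mass \<le> room + a"
    using mass_le_capacity sum_split[of c] by (simp add: room_def other_mass_def)
  moreover have "other_mass * evicted = other_mass - min room other_mass"
    using other_mass_evicted by (simp add: algebra_simps)
  ultimately show ?thesis
    using amount_nonneg by (simp add: min_def)
qed

lemma capacity_mult_evicted_le: "(K - 1) * evicted \<le> a"
proof (cases "room < other_mass")
  case True
  then have "c r < c r + a"
    using mass_le_capacity sum_split[of c] by (simp add: room_def other_mass_def)
  then have "K - 1 \<le> other_mass"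
    using True raised_le by (simp add: room_def)
  then have "(K - 1) * evicted \<le> other_mass * evicted"
    using evicted_nonneg by (rule mult_right_mono)
  then show ?thesis
    using other_mass_mult_evicted_le by linarith
next
  case False
  then show ?thesis
    using amount_nonneg by (simp add: evicted_def shrink_factor_def)
qed

lemma deposit_nonneg: "v \<in> V \<Longrightarrow> 0 \<le> deposit V K r a c v"
  using mass_nonneg amount_nonneg evicted_le_1 target
  by (cases "v = r") (auto simp: deposit_at deposit_off)

lemma sum_deposit_le: "sum (deposit V K r a c) V \<le> K"
proof -
  have "sum (deposit V K r a c) V = c r + a + other_mass * (1 - evicted)"
    by (simp add: sum_split deposit_at deposit_off other_mass_def sum_distrib_right)
  also have "\<dots> \<le> c r + a + room"
    by (simp add: other_mass_evicted)
  finally show ?thesis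
    by (simp add: room_def)
qed

lemma deposit_movement_le: "(\<Sum>v\<in>V. \<bar>deposit V K r a c v - c v\<bar>) \<le> 2 * a"
proof -
  have "\<bar>deposit V K r a c v - c v\<bar> = c v * evicted" if "v \<in> V - {r}" for v
  proof -
    have "deposit V K r a c v - c v = - (c v * evicted)"
      using that by (simp add: deposit_off algebra_simps)
    then show ?thesis
      using that mass_nonneg evicted_nonneg by simp
  qed
  then have "(\<Sum>v\<in>V. \<bar>deposit V K r a c v - c v\<bar>) = a + other_mass * evicted"
    using amount_nonneg by (simp add: sum_split deposit_at other_mass_def sum_distrib_right)
  then show ?thesis
    using other_mass_mult_evicted_le by simp
qed

lemma gap_deposit_at: "gap (deposit V K r a c r) = gap (c r) - a"
  using raised_le amount_nonneg by (auto simp: deposit_at gap_def)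

lemma sum_gap_deposit_off_le:
  assumes "\<And>v. v \<in> V \<Longrightarrow> 0 \<le> y v"
  shows "(\<Sum>v\<in>V - {r}. y v * gap (deposit V K r a c v))
    \<le> (\<Sum>v\<in>V - {r}. y v * gap (c v)) + a / (K - 1) * (\<Sum>v\<in>V - {r}. y v)"
proof -
  have evicted_le: "evicted \<le> a / (K - 1)"
    using capacity_mult_evicted_le capacity_gt_1 by (simp add: pos_le_divide_eq mult.commute)
  have "y v * gap (deposit V K r a c v) \<le> y v * gap (c v) + a / (K - 1) * y v"
    if v: "v \<in> V - {r}" for v
  proof -
    have "gap (deposit V K r a c v) \<le> gap (c v) + evicted"
      using v mass_nonneg evicted_nonneg evicted_le_1 gap_mult_le[of "c v" "1 - evicted"]
      by (simp add: deposit_off)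
    then have "y v * gap (deposit V K r a c v) \<le> y v * (gap (c v) + a / (K - 1))"
      using v assms evicted_le by (intro mult_left_mono) auto
    then show ?thesis
      by (simp add: algebra_simps)
  qed
  then have "(\<Sum>v\<in>V - {r}. y v * gap (deposit V K r a c v))
      \<le> (\<Sum>v\<in>V - {r}. y v * gap (c v) + a / (K - 1) * y v)"
    by (rule sum_mono)
  then show ?thesis
    by (simp add: sum.distrib sum_distrib_left)
qed

lemma sum_gap_deposit_le:
  assumes "\<And>v. v \<in> V \<Longrightarrow> 0 \<le> y v" and "sum y V \<le> k"
  shows "(\<Sum>v\<in>V. y v * gap (deposit V K r a c v))
    \<le> (\<Sum>v\<in>V. y v * gap (c v)) + a * ((k - y r) / (K - 1) - y r)"
proof -
  have "a / (K - 1) * (\<Sum>v\<in>V - {r}. y v) \<le> a / (K - 1) * (k - y r)"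
    using assms(2) amount_nonneg capacity_gt_1 sum_split[of y] by (intro mult_left_mono) auto
  with sum_gap_deposit_off_le[of y, OF assms(1)]
  have "(\<Sum>v\<in>V. y v * gap (deposit V K r a c v))
      \<le> (\<Sum>v\<in>V. y v * gap (c v)) - a * y r + a / (K - 1) * (k - y r)"
    by (simp add: sum_split gap_deposit_at algebra_simps)
  then show ?thesis
    by (simp add: algebra_simps)
qed

end

section \<open>The algorithm\<close>

definition raise_level :: "server_instance \<Rightarrow> (nat \<Rightarrow> nat \<Rightarrow> real) \<Rightarrow> nat \<Rightarrow> real" where
  "raise_level I x r = max 0 (MIN j\<in>{..<num_weights I}. weight I j * (1 - x r j))"

definition augmented_servers :: "server_instance \<Rightarrow> nat \<Rightarrow> nat" where
  "augmented_servers I j = 2 * num_weights I * servers I j"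

definition serve ::
    "server_instance \<Rightarrow> (nat \<Rightarrow> nat \<Rightarrow> real) \<Rightarrow> nat \<Rightarrow> nat \<Rightarrow> nat \<Rightarrow> real" where
  "serve I x r v j =
     deposit {..<num_points I} (real (augmented_servers I j)) r
       (raise_level I x r / weight I j) (\<lambda>u. x u j) v"

definition serve_all :: online_alg where
  "serve_all I = foldl (serve I) (\<lambda>v j. real (init I v j))"

lemma serve_all_Nil: "serve_all I [] = (\<lambda>v j. real (init I v j))"
  by (simp add: serve_all_def)

lemma serve_all_take_Suc:
  "t < length \<sigma> \<Longrightarrow> serve_all I (take (Suc t) \<sigma>) = serve I (serve_all I (take t \<sigma>)) (\<sigma> ! t)"
  by (simp add: serve_all_def take_Suc_conv_app_nth)

definition configuration ::
    "server_instance \<Rightarrow> (nat \<Rightarrow> nat) \<Rightarrow> (nat \<Rightarrow> nat \<Rightarrow> real) \<Rightarrow> bool" where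
  "configuration I cap x \<longleftrightarrow>
     (\<forall>v<num_points I. \<forall>j<num_weights I. 0 \<le> x v j) \<and>
     (\<forall>j<num_weights I. (\<Sum>v<num_points I. x v j) \<le> real (cap j))"

lemma configuration_nonneg:
  "configuration I cap x \<Longrightarrow> v < num_points I \<Longrightarrow> j < num_weights I \<Longrightarrow> 0 \<le> x v j"
  by (simp add: configuration_def)

lemma configuration_sum_le:
  "configuration I cap x \<Longrightarrow> j < num_weights I \<Longrightarrow> (\<Sum>v<num_points I. x v j) \<le> real (cap j)"
  by (simp add: configuration_def)

lemma fractional_solution_iff_configuration:
  "fractional_solution I cap T x \<longleftrightarrow>
    (\<forall>v<num_points I. \<forall>j<num_weights I. x v j 0 = real (init I v j)) \<and>
    (\<forall>t\<le>T. configuration I cap (\<lambda>v j. x v j t))"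
  by (auto simp: fractional_solution_def configuration_def)

lemma weight_pos: "valid_instance I \<Longrightarrow> j < num_weights I \<Longrightarrow> 0 < weight I j"
  by (simp add: valid_instance_def)

lemma num_weights_pos: "valid_instance I \<Longrightarrow> 0 < num_weights I"
  by (simp add: valid_instance_def)

lemma servers_pos: "valid_instance I \<Longrightarrow> j < num_weights I \<Longrightarrow> 0 < servers I j"
  by (simp add: valid_instance_def Suc_le_eq)

lemma servers_le_augmented: "valid_instance I \<Longrightarrow> servers I j \<le> augmented_servers I j"
  using num_weights_pos[of I] by (cases "num_weights I") (auto simp: augmented_servers_def)

lemma init_sum_le:
  assumes "valid_instance I" "j < num_weights I"
  shows "(\<Sum>v<num_points I. real (init I v j)) \<le> real (servers I j)"
proof -
  have "real (\<Sum>v<num_points I. init I v j) \<le> real (servers I j)"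
    using assms by (simp add: valid_instance_def del: of_nat_sum)
  then show ?thesis
    by simp
qed

lemma augmented_servers_gt_1:
  assumes "valid_instance I" "j < num_weights I"
  shows "1 < augmented_servers I j"
proof -
  have "0 < num_weights I * servers I j"
    using num_weights_pos[OF assms(1)] servers_pos[OF assms] by simp
  then show ?thesis
    unfolding augmented_servers_def by linarith
qed

lemma raise_level_nonneg: "0 \<le> raise_level I x r"
  by (simp add: raise_level_def)

lemma raise_level_attained:
  assumes "0 < num_weights I"
  shows "\<exists>j<num_weights I. weight I j * (1 - x r j) \<le> raise_level I x r"
proof -
  let ?W = "(\<lambda>j. weight I j * (1 - x r j)) ` {..<num_weights I}"
  have "Min ?W \<in> ?W"
    using assms by (intro Min_in) auto
  then obtain j where "j < num_weights I" "weight I j * (1 - x r j) = Min ?W"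
    by auto
  then show ?thesis
    by (auto simp: raise_level_def)
qed

lemma raise_level_le:
  assumes "j < num_weights I"
  shows "raise_level I x r \<le> max 0 (weight I j * (1 - x r j))"
  using assms unfolding raise_level_def by (intro max.mono Min_le) auto

lemma raised_mass_le:
  assumes "j < num_weights I" "0 < weight I j"
  shows "x r j + raise_level I x r / weight I j \<le> max 1 (x r j)"
proof -
  have "raise_level I x r / weight I j \<le> max 0 (weight I j * (1 - x r j)) / weight I j"
    using assms raise_level_le by (intro divide_right_mono) auto
  also have "\<dots> = max 0 (1 - x r j)"
    using assms(2) by (auto simp: max_def zero_le_mult_iff)
  finally show ?thesis
    by simp
qed

lemma unit_deposit_serve:
  assumes "valid_instance I" "configuration I (augmented_servers I) x"
    "r < num_points I" "j < num_weights I"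
  shows "unit_deposit {..<num_points I} (real (augmented_servers I j)) r
    (raise_level I x r / weight I j) (\<lambda>v. x v j)"
  using configuration_nonneg[OF assms(2) _ assms(4)] configuration_sum_le[OF assms(2,4)]
    augmented_servers_gt_1[OF assms(1,4)] raise_level_nonneg[of I x r] assms(3)
    raised_mass_le[of j I x r, OF assms(4) weight_pos[OF assms(1,4)]] weight_pos[OF assms(1,4)]
  by unfold_locales simp_all

lemma configuration_serve:
  assumes "valid_instance I" "configuration I (augmented_servers I) x" "r < num_points I"
  shows "configuration I (augmented_servers I) (serve I x r)"
proof -
  have "0 \<le> serve I x r v j" if "v < num_points I" "j < num_weights I" for v j
    using unit_deposit.deposit_nonneg[OF unit_deposit_serve[OF assms]] that by (simp add: serve_def)
  moreover have "(\<Sum>v<num_points I. serve I x r v j) \<le> real (augmented_servers I j)"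
    if "j < num_weights I" for j
    using unit_deposit.sum_deposit_le[OF unit_deposit_serve[OF assms that]] by (simp add: serve_def)
  ultimately show ?thesis
    by (simp add: configuration_def)
qed

lemma serve_covers:
  assumes "valid_instance I"
  shows "\<exists>j<num_weights I. 1 \<le> serve I x r r j"
proof -
  obtain j where j: "j < num_weights I" "weight I j * (1 - x r j) \<le> raise_level I x r"
    using raise_level_attained[OF num_weights_pos[OF assms]] by blast
  then have "1 \<le> serve I x r r j"
    using weight_pos[OF assms j(1)] by (simp add: serve_def deposit_def field_simps)
  then show ?thesis
    using j(1) by blast
qed

lemma configuration_init:
  assumes "valid_instance I"
  shows "configuration I (augmented_servers I) (\<lambda>v j. real (init I v j))"
proof -
  have "(\<Sum>v<num_points I. real (init I v j)) \<le> real (augmented_servers I j)"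
    if "j < num_weights I" for j
    using init_sum_le[OF assms that] servers_le_augmented[OF assms, of j] by linarith
  then show ?thesis
    by (simp add: configuration_def)
qed

lemma valid_requests_nth: "valid_requests I \<sigma> \<Longrightarrow> t < length \<sigma> \<Longrightarrow> \<sigma> ! t < num_points I"
  using nth_mem unfolding valid_requests_def by blast

lemma configuration_serve_all:
  assumes "valid_instance I" "valid_requests I \<sigma>"
  shows "configuration I (augmented_servers I) (serve_all I \<sigma>)"
  using assms(2)
proof (induction \<sigma> rule: rev_induct)
  case Nil
  show ?case
    using configuration_init[OF assms(1)] by (simp add: serve_all_Nil)
next
  case (snoc r \<sigma>)
  then show ?case
    using configuration_serve[OF assms(1)] by (simp add: serve_all_def valid_requests_def)
qed

lemma valid_requests_take: "valid_requests I \<sigma> \<Longrightarrow> valid_requests I (take t \<sigma>)"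
  using set_take_subset[of t \<sigma>] unfolding valid_requests_def by (rule order_trans)

lemma fractional_solution_serve_all:
  assumes "valid_instance I" "valid_requests I \<sigma>"
  shows "fractional_solution I (augmented_servers I) (length \<sigma>) (trajectory serve_all I \<sigma>)"
  using assms configuration_serve_all valid_requests_take
  by (simp add: fractional_solution_iff_configuration trajectory_def serve_all_Nil)

lemma single_weight_service_serve_all:
  assumes "valid_instance I"
  shows "single_weight_service I \<sigma> (trajectory serve_all I \<sigma>)"
  unfolding single_weight_service_def
proof
  fix t assume "t \<in> {1..length \<sigma>}"
  then obtain u where "t = Suc u" "u < length \<sigma>"
    by (cases t) auto
  then show "\<exists>j<num_weights I. 1 \<le> trajectory serve_all I \<sigma> (\<sigma> ! (t - 1)) j t"
    using serve_covers[OF assms] by (simp add: trajectory_def serve_all_take_Suc)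
qed

section \<open>The competitive ratio\<close>

definition move_cost ::
    "server_instance \<Rightarrow> (nat \<Rightarrow> nat \<Rightarrow> real) \<Rightarrow> (nat \<Rightarrow> nat \<Rightarrow> real) \<Rightarrow> real" where
  "move_cost I x x' =
     1/2 * (\<Sum>j<num_weights I. weight I j * (\<Sum>v<num_points I. \<bar>x' v j - x v j\<bar>))"

definition potential ::
    "server_instance \<Rightarrow> (nat \<Rightarrow> nat \<Rightarrow> real) \<Rightarrow> (nat \<Rightarrow> nat \<Rightarrow> real) \<Rightarrow> real" where
  "potential I y x =
     (\<Sum>j<num_weights I. weight I j * (\<Sum>v<num_points I. y v j * gap (x v j)))"

lemma movement_cost_eq_sum_move_cost:
  "movement_cost I T x = (\<Sum>t<T. move_cost I (\<lambda>v j. x v j t) (\<lambda>v j. x v j (Suc t)))"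
proof -
  let ?moved = "\<lambda>j t. \<Sum>v<num_points I. \<bar>x v j (Suc t) - x v j t\<bar>"
  have "movement_cost I T x = 1/2 * (\<Sum>j<num_weights I. \<Sum>t<T. weight I j * ?moved j t)"
    by (simp add: movement_cost_def sum.atLeast1_atMost_eq sum_distrib_left)
  also have "\<dots> = 1/2 * (\<Sum>t<T. \<Sum>j<num_weights I. weight I j * ?moved j t)"
    by (subst sum.swap) (rule refl)
  finally show ?thesis
    by (simp add: move_cost_def sum_distrib_left)
qed

lemma potential_nonneg:
  assumes "valid_instance I" "configuration I cap y"
  shows "0 \<le> potential I y x"
  using assms unfolding potential_def
  by (intro sum_nonneg mult_nonneg_nonneg)
    (auto simp: gap_nonneg configuration_nonneg intro: less_imp_le weight_pos)

lemma potential_init: "potential I (\<lambda>v j. real (init I v j)) (\<lambda>v j. real (init I v j)) = 0"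
proof -
  have nat_gap: "real m * gap (real m) = 0" for m
    by (cases m) (auto simp: gap_def)
  show ?thesis
    by (simp add: potential_def nat_gap)
qed

lemma move_cost_serve_le:
  assumes "valid_instance I" "configuration I (augmented_servers I) x" "r < num_points I"
  shows "move_cost I x (serve I x r) \<le> real (num_weights I) * raise_level I x r"
proof -
  have "weight I j * (\<Sum>v<num_points I. \<bar>serve I x r v j - x v j\<bar>) \<le> 2 * raise_level I x r"
    if j: "j < num_weights I" for j
  proof -
    have "weight I j * (\<Sum>v<num_points I. \<bar>serve I x r v j - x v j\<bar>)
        \<le> weight I j * (2 * (raise_level I x r / weight I j))"
      unfolding serve_def
      using unit_deposit.deposit_movement_le[OF unit_deposit_serve[OF assms j]]
        weight_pos[OF assms(1) j]
      by (intro mult_left_mono) auto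
    then show ?thesis
      using weight_pos[OF assms(1) j] by simp
  qed
  then have "(\<Sum>j<num_weights I. weight I j * (\<Sum>v<num_points I. \<bar>serve I x r v j - x v j\<bar>))
      \<le> (\<Sum>j<num_weights I. 2 * raise_level I x r)"
    by (intro sum_mono) auto
  then show ?thesis
    by (simp add: move_cost_def)
qed

text \<open>Bounds the growth of the potential of a class per unit of the raise level, if the reference
  solution has \<open>k\<close> units in the class, \<open>y\<close> of them at the request.\<close>

definition drift :: "real \<Rightarrow> real \<Rightarrow> real \<Rightarrow> real" where
  "drift l k y = (k - y) / (2 * l * k - 1) - y"

lemma class_potential_serve_le:
  assumes valid: "valid_instance I" and x: "configuration I (augmented_servers I) x"
    and r: "r < num_points I" and j: "j < num_weights I" and y: "configuration I (servers I) y"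
  shows "weight I j * (\<Sum>v<num_points I. y v j * gap (serve I x r v j))
    \<le> weight I j * (\<Sum>v<num_points I. y v j * gap (x v j))
      + raise_level I x r * drift (real (num_weights I)) (real (servers I j)) (y r j)"
    (is "_ \<le> weight I j * ?P + raise_level I x r * ?d")
proof -
  interpret unit_deposit "{..<num_points I}" "real (augmented_servers I j)" r
    "raise_level I x r / weight I j" "\<lambda>v. x v j"
    using assms by (intro unit_deposit_serve)
  have "?d = (real (servers I j) - y r j) / (real (augmented_servers I j) - 1) - y r j"
    by (simp add: drift_def augmented_servers_def)
  then have "(\<Sum>v<num_points I. y v j * gap (serve I x r v j))
      \<le> ?P + raise_level I x r / weight I j * ?d"
    using configuration_nonneg[OF y] configuration_sum_le[OF y] j
      sum_gap_deposit_le[of "\<lambda>v. y v j"]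
    by (simp add: serve_def)
  then have "weight I j * (\<Sum>v<num_points I. y v j * gap (serve I x r v j))
      \<le> weight I j * (?P + raise_level I x r / weight I j * ?d)"
    using weight_pos[OF valid j] by (intro mult_left_mono) auto
  then show ?thesis
    using weight_pos[OF valid j] by (simp add: distrib_left)
qed

lemma drift_single_class_le:
  assumes "1 \<le> k" "1 \<le> y"
  shows "drift 1 k y \<le> - 1 / 3"
proof -
  have "(k - y) / (2 * k - 1) \<le> (k - 1) / (2 * k - 1)"
    using assms by (intro divide_right_mono) auto
  also have "\<dots> \<le> 1 / 2"
    using assms(1) by (simp add: field_simps)
  finally show ?thesis
    using assms(2) unfolding drift_def mult_1_right by linarith
qed

lemma drift_le:
  assumes "2 \<le> l" "1 \<le> k" "0 \<le> y"
  shows "drift l k y \<le> 2 / (3 * l) - y"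
proof -
  have "2 * 1 \<le> l * k"
    using assms by (intro mult_mono) auto
  then have "0 < 2 * l * k - 1" "k * (3 * l) \<le> 2 * (2 * l * k - 1)"
    by (simp_all add: algebra_simps)
  then have "k / (2 * l * k - 1) \<le> 2 / (3 * l)"
    using assms(1) by (simp add: divide_le_eq le_divide_eq)
  moreover have "(k - y) / (2 * l * k - 1) \<le> k / (2 * l * k - 1)"
    using assms(3) \<open>0 < 2 * l * k - 1\<close> by (intro divide_right_mono) auto
  ultimately show ?thesis
    by (simp add: drift_def)
qed

text \<open>With one class the reference solution has at most \<open>k - 1\<close> mass off the request; without
  using this, \<open>l = k = 1\<close> would leave no slack.\<close>

lemma sum_drift_le:
  fixes k y :: "'a \<Rightarrow> real"
  assumes "finite J" and k: "\<And>j. j \<in> J \<Longrightarrow> 1 \<le> k j" and y: "\<And>j. j \<in> J \<Longrightarrow> 0 \<le> y j"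
    and cover: "1 \<le> sum y J"
  shows "(\<Sum>j\<in>J. drift (real (card J)) (k j) (y j)) \<le> - 1 / 3"
proof (cases "card J = 1")
  case True
  then obtain j where "J = {j}"
    by (auto simp: card_1_singleton_iff)
  then show ?thesis
    using drift_single_class_le k cover by simp
next
  case False
  have "J \<noteq> {}"
    using cover by auto
  then have card: "2 \<le> card J"
    using False \<open>finite J\<close> card_0_eq[of J] by linarith
  then have "(\<Sum>j\<in>J. drift (real (card J)) (k j) (y j)) \<le> (\<Sum>j\<in>J. 2 / (3 * real (card J)) - y j)"
    using k y by (intro sum_mono drift_le) auto
  also have "\<dots> = 2 / 3 - sum y J"
    using card by (simp add: sum_subtractf)
  finally show ?thesis
    using cover by simp
qed

lemma potential_serve_le:
  assumes valid: "valid_instance I" and x: "configuration I (augmented_servers I) x"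
    and r: "r < num_points I" and y: "configuration I (servers I) y"
    and cover: "1 \<le> (\<Sum>j<num_weights I. y r j)"
  shows "potential I y (serve I x r) \<le> potential I y x - raise_level I x r / 3"
proof -
  let ?d = "\<lambda>j. drift (real (num_weights I)) (real (servers I j)) (y r j)"
  have "(\<Sum>j<num_weights I. ?d j) \<le> - 1 / 3"
    using sum_drift_le[of "{..<num_weights I}" "\<lambda>j. real (servers I j)" "y r"]
      servers_pos[OF valid] configuration_nonneg[OF y r] cover
    by (simp add: Suc_le_eq)
  then have "raise_level I x r * (\<Sum>j<num_weights I. ?d j) \<le> raise_level I x r * (- 1 / 3)"
    using raise_level_nonneg by (rule mult_left_mono)
  moreover have "potential I y (serve I x r)
      \<le> potential I y x + raise_level I x r * (\<Sum>j<num_weights I. ?d j)"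
    unfolding potential_def sum_distrib_left[of "raise_level I x r"] sum.distrib[symmetric]
    using class_potential_serve_le[OF valid x r _ y] by (intro sum_mono) auto
  ultimately show ?thesis
    by simp
qed

lemma potential_le_add_move_cost:
  assumes "valid_instance I" "configuration I cap x"
  shows "potential I y' x \<le> potential I y x + 2 * move_cost I y y'"
proof -
  have term_le: "y' v j * gap (x v j) \<le> y v j * gap (x v j) + \<bar>y' v j - y v j\<bar>"
    if "v < num_points I" "j < num_weights I" for v j
  proof -
    have "(y' v j - y v j) * gap (x v j) \<le> \<bar>y' v j - y v j\<bar> * 1"
      using gap_nonneg gap_le_1 configuration_nonneg[OF assms(2) that] by (intro mult_mono) auto
    then show ?thesis
      by (simp add: algebra_simps)
  qed
  have "potential I y' x \<le> (\<Sum>j<num_weights I. weight I j *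
      (\<Sum>v<num_points I. y v j * gap (x v j) + \<bar>y' v j - y v j\<bar>))"
    unfolding potential_def
    using term_le weight_pos[OF assms(1)]
    by (intro sum_mono mult_left_mono) (auto intro: less_imp_le)
  then show ?thesis
    by (simp add: potential_def move_cost_def sum.distrib distrib_left)
qed

lemma serve_amortized_cost_le:
  assumes "valid_instance I" "configuration I (augmented_servers I) x" "r < num_points I"
    "configuration I (servers I) y'" "1 \<le> (\<Sum>j<num_weights I. y' r j)"
  shows "move_cost I x (serve I x r) + 3 * real (num_weights I) * potential I y' (serve I x r)
    \<le> 3 * real (num_weights I) * potential I y x + 6 * real (num_weights I) * move_cost I y y'"
proof -
  have "potential I y' (serve I x r)
      \<le> potential I y x + 2 * move_cost I y y' - raise_level I x r / 3"
    using potential_serve_le[OF assms] potential_le_add_move_cost[OF assms(1,2), of y' y]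
    by linarith
  then have "3 * real (num_weights I) * potential I y' (serve I x r)
      \<le> 3 * real (num_weights I) * (potential I y x + 2 * move_cost I y y' - raise_level I x r / 3)"
    by (intro mult_left_mono) auto
  then show ?thesis
    using move_cost_serve_le[OF assms(1-3)] by (simp add: algebra_simps)
qed

lemma amortized_sum_le:
  fixes \<Phi> cost budget :: "nat \<Rightarrow> 'a::ordered_ab_group_add"
  assumes "\<And>t. t < n \<Longrightarrow> cost t + \<Phi> (Suc t) \<le> \<Phi> t + budget t"
  shows "(\<Sum>t<n. cost t) + \<Phi> n \<le> \<Phi> 0 + (\<Sum>t<n. budget t)"
  using assms
proof (induction n)
  case (Suc n)
  have "(\<Sum>t<Suc n. cost t) + \<Phi> (Suc n) = (\<Sum>t<n. cost t) + (cost n + \<Phi> (Suc n))"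
    by (simp add: add.assoc)
  also have "\<dots> \<le> (\<Sum>t<n. cost t) + (\<Phi> n + budget n)"
    using Suc.prems by (intro add_left_mono) simp
  also have "\<dots> \<le> \<Phi> 0 + (\<Sum>t<n. budget t) + budget n"
    using Suc by (simp add: add_right_mono flip: add.assoc)
  finally show ?case
    by (simp add: add.assoc)
qed simp

lemma trajectory_cost_le:
  assumes valid: "valid_instance I" and requests: "valid_requests I \<sigma>"
    and feasible: "lp_feasible I \<sigma> y"
  shows "movement_cost I (length \<sigma>) (trajectory serve_all I \<sigma>)
    \<le> 6 * real (num_weights I) * movement_cost I (length \<sigma>) y"
proof -
  define X where "X t = serve_all I (take t \<sigma>)" for t
  define Y where "Y t = (\<lambda>v j. y v j t)" for t
  define \<Phi> where "\<Phi> t = 3 * real (num_weights I) * potential I (Y t) (X t)" for t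
  have X: "configuration I (augmented_servers I) (X t)" for t
    using valid requests by (simp add: X_def configuration_serve_all valid_requests_take)
  have Y: "configuration I (servers I) (Y t)" if "t \<le> length \<sigma>" for t
    using feasible that by (simp add: lp_feasible_def fractional_solution_iff_configuration Y_def)
  have step: "move_cost I (X t) (X (Suc t)) + \<Phi> (Suc t)
      \<le> \<Phi> t + 6 * real (num_weights I) * move_cost I (Y t) (Y (Suc t))"
    if t: "t < length \<sigma>" for t
  proof -
    have "1 \<le> (\<Sum>j<num_weights I. Y (Suc t) (\<sigma> ! t) j)"
      using feasible t by (force simp: lp_feasible_def Y_def)
    moreover have "X (Suc t) = serve I (X t) (\<sigma> ! t)"
      using t by (simp add: X_def serve_all_take_Suc)
    ultimately show ?thesis
      using serve_amortized_cost_le[OF valid X valid_requests_nth[OF requests t] Y] t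
      by (simp add: \<Phi>_def)
  qed
  have "\<Phi> 0 = 3 * real (num_weights I) *
      potential I (\<lambda>v j. real (init I v j)) (\<lambda>v j. real (init I v j))"
    using feasible by (simp add: \<Phi>_def X_def Y_def serve_all_Nil potential_def
        lp_feasible_def fractional_solution_def)
  moreover have "0 \<le> \<Phi> (length \<sigma>)"
    using potential_nonneg[OF valid Y] by (simp add: \<Phi>_def)
  ultimately have "(\<Sum>t<length \<sigma>. move_cost I (X t) (X (Suc t)))
      \<le> (\<Sum>t<length \<sigma>. 6 * real (num_weights I) * move_cost I (Y t) (Y (Suc t)))"
    using amortized_sum_le[of "length \<sigma>" _ \<Phi>, OF step] potential_init by simp
  then show ?thesis
    by (simp add: movement_cost_eq_sum_move_cost trajectory_def sum_distrib_left X_def Y_def)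
qed

lemma lp_feasible_exists:
  assumes valid: "valid_instance I"
  shows "\<exists>x. lp_feasible I \<sigma> x"
proof -
  define x :: "nat \<Rightarrow> nat \<Rightarrow> nat \<Rightarrow> real" where
    "x v j t = (if t = 0 then real (init I v j) else of_bool (v = \<sigma> ! (t - 1) \<and> j = 0))" for v j t
  have "(\<Sum>v<num_points I. x v j t) \<le> real (servers I j)" if j: "j < num_weights I" for j t
  proof (cases "t = 0")
    case True
    then show ?thesis
      using init_sum_le[OF valid j] by (simp add: x_def)
  next
    case False
    then have "(\<Sum>v<num_points I. x v j t) \<le> (\<Sum>v<num_points I. if v = \<sigma> ! (t - 1) then 1 else 0)"
      by (intro sum_mono) (simp add: x_def)
    also have "\<dots> \<le> 1"
      by (simp add: sum.delta)
    also have "\<dots> \<le> real (servers I j)"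
      using servers_pos[OF valid j] by (simp add: Suc_le_eq)
    finally show ?thesis .
  qed
  then have "fractional_solution I (servers I) (length \<sigma>) x"
    by (simp add: fractional_solution_def) (simp add: x_def)
  moreover have "1 \<le> (\<Sum>j<num_weights I. x (\<sigma> ! (t - 1)) j t)" if "t \<in> {1..length \<sigma>}" for t
  proof -
    have "x (\<sigma> ! (t - 1)) 0 t \<le> (\<Sum>j<num_weights I. x (\<sigma> ! (t - 1)) j t)"
      using num_weights_pos[OF valid] by (intro member_le_sum) (auto simp: x_def)
    then show ?thesis
      using that by (simp add: x_def)
  qed
  ultimately show ?thesis
    unfolding lp_feasible_def by blast
qed

lemma trajectory_competitive:
  assumes valid: "valid_instance I" and requests: "valid_requests I \<sigma>"
  shows "movement_cost I (length \<sigma>) (trajectory serve_all I \<sigma>)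
    \<le> 6 * real (num_weights I) * lp_opt I \<sigma>"
proof -
  let ?cost = "movement_cost I (length \<sigma>) (trajectory serve_all I \<sigma>)"
  have pos: "0 < 6 * real (num_weights I)"
    using num_weights_pos[OF valid] by simp
  have "?cost / (6 * real (num_weights I)) \<le> lp_opt I \<sigma>"
    unfolding lp_opt_def
  proof (rule cInf_greatest)
    show "movement_cost I (length \<sigma>) ` {x. lp_feasible I \<sigma> x} \<noteq> {}"
      using lp_feasible_exists[OF valid] by simp
    fix b assume "b \<in> movement_cost I (length \<sigma>) ` {x. lp_feasible I \<sigma> x}"
    then show "?cost / (6 * real (num_weights I)) \<le> b"
      using trajectory_cost_le[OF assms] pos by (auto simp: pos_divide_le_eq mult.commute)
  qed
  then show ?thesis
    using pos by (simp add: pos_divide_le_eq mult.commute)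
qed

section \<open>Time-bounded total correctness\<close>

definition hoare :: "nat \<Rightarrow> (ram_state \<Rightarrow> bool) \<Rightarrow> com \<Rightarrow> (ram_state \<Rightarrow> bool) \<Rightarrow> bool"
    ("\<turnstile>\<^bsub>_\<^esub> {_}/ _/ {_}" [0, 0, 0, 0] 50) where
  "\<turnstile>\<^bsub>t\<^esub> {P} c {Q} \<longleftrightarrow> (\<forall>s. P s \<longrightarrow> (\<exists>t' s'. runs c s t' s' \<and> t' \<le> t \<and> Q s'))"

abbreviation seq :: "com \<Rightarrow> com \<Rightarrow> com" (infixl ";;" 60) where
  "c ;; d \<equiv> Seq c d"

lemma hoareE:
  assumes "\<turnstile>\<^bsub>t\<^esub> {P} c {Q}" "P s"
  obtains t' s' where "runs c s t' s'" "t' \<le> t" "Q s'"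
  using assms unfolding hoare_def by blast

lemma hoare_conseq:
  assumes "\<turnstile>\<^bsub>t\<^esub> {P} c {Q}" "\<And>s. P' s \<Longrightarrow> P s" "\<And>s. Q s \<Longrightarrow> Q' s" "t \<le> t'"
  shows "\<turnstile>\<^bsub>t'\<^esub> {P'} c {Q'}"
  using assms unfolding hoare_def by (meson le_trans)

lemma hoare_Skip: "(\<And>s. P s \<Longrightarrow> Q s) \<Longrightarrow> \<turnstile>\<^bsub>1\<^esub> {P} Skip {Q}"
  unfolding hoare_def using runs.Skip by blast

lemma hoare_NAssign:
  "(\<And>s. P s \<Longrightarrow> Q (upd (fst s) a (nval i s) (nval e s), snd s)) \<Longrightarrow> \<turnstile>\<^bsub>1\<^esub> {P} NAssign a i e {Q}"
  unfolding hoare_def using runs.NAssign by blast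

lemma hoare_RAssign:
  "(\<And>s. P s \<Longrightarrow> Q (fst s, upd (snd s) a (nval i s) (rval e s))) \<Longrightarrow> \<turnstile>\<^bsub>1\<^esub> {P} RAssign a i e {Q}"
  unfolding hoare_def using runs.RAssign by blast

lemma hoare_Seq [trans]:
  assumes "\<turnstile>\<^bsub>t\<^esub> {P} c {Q}" "\<turnstile>\<^bsub>u\<^esub> {Q} d {R}"
  shows "\<turnstile>\<^bsub>t + u\<^esub> {P} c ;; d {R}"
  unfolding hoare_def
proof (intro allI impI)
  fix s assume "P s"
  then obtain t' s' where run_c: "runs c s t' s'" "t' \<le> t" "Q s'"
    by (rule hoareE[OF assms(1)])
  from \<open>Q s'\<close> obtain u' s'' where run_d: "runs d s' u' s''" "u' \<le> u" "R s''"
    by (rule hoareE[OF assms(2)])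
  have "runs (c ;; d) s (t' + u') s''"
    using run_c run_d by (intro runs.Seq)
  then show "\<exists>t' s'. runs (c ;; d) s t' s' \<and> t' \<le> t + u \<and> R s'"
    using run_c run_d by (meson add_mono)
qed

lemma hoare_Cond:
  assumes "\<turnstile>\<^bsub>t\<^esub> {\<lambda>s. P s \<and> bval b s} c {Q}" "\<turnstile>\<^bsub>t\<^esub> {\<lambda>s. P s \<and> \<not> bval b s} d {Q}"
  shows "\<turnstile>\<^bsub>t + 1\<^esub> {P} Cond b c d {Q}"
  unfolding hoare_def
proof (intro allI impI)
  fix s assume P: "P s"
  show "\<exists>t' s'. runs (Cond b c d) s t' s' \<and> t' \<le> t + 1 \<and> Q s'"
  proof (cases "bval b s")
    case True
    then obtain t' s' where "runs c s t' s'" "t' \<le> t" "Q s'"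
      using hoareE[OF assms(1)] P by blast
    then show ?thesis
      using runs.CondTrue[OF True] by (meson add_le_mono1)
  next
    case False
    then obtain t' s' where "runs d s t' s'" "t' \<le> t" "Q s'"
      using hoareE[OF assms(2)] P by blast
    then show ?thesis
      using runs.CondFalse[OF False] by (meson add_le_mono1)
  qed
qed

lemma hoare_While_from:
  assumes guard: "\<And>i s. i \<le> n \<Longrightarrow> P i s \<Longrightarrow> bval b s \<longleftrightarrow> i < n"
    and body: "\<And>i. i < n \<Longrightarrow> \<turnstile>\<^bsub>t\<^esub> {P i} c {P (Suc i)}"
    and "i \<le> n"
  shows "\<turnstile>\<^bsub>(n - i) * (t + 1) + 1\<^esub> {P i} While b c {P n}"
  using \<open>i \<le> n\<close>
proof (induction rule: inc_induct)
  case base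
  show ?case
    using guard[of n] runs.WhileFalse[of b _ c] unfolding hoare_def by fastforce
next
  case (step i)
  have time: "(n - i) * (t + 1) = (n - Suc i) * (t + 1) + (t + 1)"
    using step.hyps by (metis Suc_diff_Suc add.commute mult_Suc)
  show ?case
    unfolding hoare_def
  proof (intro allI impI)
    fix s assume P: "P i s"
    then have continue: "bval b s"
      using guard[of i s] step.hyps by simp
    obtain t1 s1 where iteration: "runs c s t1 s1" "t1 \<le> t" "P (Suc i) s1"
      using hoareE[OF body P] step.hyps by blast
    obtain t2 s2 where rest: "runs (While b c) s1 t2 s2" "t2 \<le> (n - Suc i) * (t + 1) + 1" "P n s2"
      using hoareE[OF step.IH iteration(3)] by blast
    have "runs (While b c) s (t1 + t2 + 1) s2"
      using continue iteration(1) rest(1) by (rule runs.WhileTrue)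
    moreover have "t1 + t2 + 1 \<le> (n - i) * (t + 1) + 1"
      using iteration(2) rest(2) time by linarith
    ultimately show "\<exists>t' s'. runs (While b c) s t' s' \<and> t' \<le> (n - i) * (t + 1) + 1 \<and> P n s'"
      using rest(3) by blast
  qed
qed

section \<open>Programs over scalar variables and the configuration array\<close>

text \<open>The scalar variables are the zeroth cells of the arrays that hold no input or output.\<close>

abbreviation NVar :: "nat \<Rightarrow> nexp" where
  "NVar a \<equiv> NCell a (NConst 0)"

abbreviation RVar :: "nat \<Rightarrow> rexp" where
  "RVar a \<equiv> RCell a (NConst 0)"

abbreviation NSet :: "nat \<Rightarrow> nexp \<Rightarrow> com" where
  "NSet a e \<equiv> NAssign a (NConst 0) e"

abbreviation RSet :: "nat \<Rightarrow> rexp \<Rightarrow> com" where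
  "RSet a e \<equiv> RAssign a (NConst 0) e"

definition For :: "nat \<Rightarrow> nexp \<Rightarrow> com \<Rightarrow> com" where
  "For a e c =
     NSet a (NConst 0) ;; While (NLess (NVar a) e) (c ;; NSet a (NAdd (NVar a) (NConst 1)))"

text \<open>The scalar values are given by partial maps, so that a specification with arbitrary maps
  also says which variables a program leaves alone.\<close>

definition memory ::
    "server_instance \<Rightarrow> nat list \<Rightarrow> (nat \<Rightarrow> nat \<Rightarrow> real) \<Rightarrow> (nat \<rightharpoonup> nat) \<Rightarrow> (nat \<rightharpoonup> real) \<Rightarrow>
      ram_state \<Rightarrow> bool" where
  "memory I \<sigma> x \<nu> \<rho> s \<longleftrightarrow>
     (\<forall>a\<le>3. fst s a = fst (input_state I \<sigma>) a) \<and> snd s 0 = snd (input_state I \<sigma>) 0 \<and>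
     (\<forall>v<num_points I. \<forall>j<num_weights I. ram_output I s v j = x v j) \<and>
     (\<forall>a\<in>dom \<nu>. 3 < a \<and> fst s a 0 = the (\<nu> a)) \<and>
     (\<forall>a\<in>dom \<rho>. 1 < a \<and> snd s a 0 = the (\<rho> a))"

lemmas memory_simps = memory_def input_state_def ram_output_def

lemma upd_apply: "upd m a i y b k = (if b = a \<and> k = i then y else m b k)"
  by (simp add: upd_def)

lemma upd_row: "b \<noteq> a \<Longrightarrow> upd m a i y b = m b"
  by (simp add: upd_def)

lemma row_major_eq_iff:
  fixes l :: nat
  assumes "j < l" "j' < l"
  shows "v * l + j = v' * l + j' \<longleftrightarrow> v = v' \<and> j = j'"
proof
  assume eq: "v * l + j = v' * l + j'"
  have "(v * l + j) div l = v" "(v' * l + j') div l = v'"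
    using assms by auto
  then show "v = v' \<and> j = j'"
    using eq by auto
qed simp

lemma row_major_less:
  fixes l :: nat
  assumes "v < n" "j < l"
  shows "v * l + j < n * l"
proof -
  have "v * l + j < Suc v * l"
    using assms by simp
  also have "\<dots> \<le> n * l"
    using assms by (intro mult_le_mono) auto
  finally show ?thesis .
qed

lemma memory_nat_var: "memory I \<sigma> x \<nu> \<rho> s \<Longrightarrow> \<nu> a = Some y \<Longrightarrow> fst s a 0 = y"
  by (simp add: memory_def domIff)

lemma memory_mono:
  assumes "memory I \<sigma> x \<nu> \<rho> s" "\<nu>' \<subseteq>\<^sub>m \<nu>" "\<rho>' \<subseteq>\<^sub>m \<rho>"
    and "\<And>v j. v < num_points I \<Longrightarrow> j < num_weights I \<Longrightarrow> x v j = x' v j"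
  shows "memory I \<sigma> x' \<nu>' \<rho>' s"
proof -
  have "a \<in> dom \<nu> \<and> \<nu>' a = \<nu> a" if "a \<in> dom \<nu>'" for a
    using assms(2) that by (metis map_le_def domIff)
  moreover have "a \<in> dom \<rho> \<and> \<rho>' a = \<rho> a" if "a \<in> dom \<rho>'" for a
    using assms(3) that by (metis map_le_def domIff)
  ultimately show ?thesis
    using assms(1,4) unfolding memory_def by simp
qed

lemma memory_conseq:
  assumes "\<turnstile>\<^bsub>t\<^esub> {P} c {memory I \<sigma> x \<nu> \<rho>}" "t \<le> t'" "\<nu>' \<subseteq>\<^sub>m \<nu>" "\<rho>' \<subseteq>\<^sub>m \<rho>"
    and "\<And>v j. v < num_points I \<Longrightarrow> j < num_weights I \<Longrightarrow> x v j = x' v j"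
  shows "\<turnstile>\<^bsub>t'\<^esub> {P} c {memory I \<sigma> x' \<nu>' \<rho>'}"
  by (rule hoare_conseq[OF assms(1) _ _ assms(2)]) (auto intro: memory_mono assms)

lemma memory_NSet:
  assumes "3 < a" "\<And>s. memory I \<sigma> x \<nu> \<rho> s \<Longrightarrow> nval e s = y"
  shows "\<turnstile>\<^bsub>1\<^esub> {memory I \<sigma> x \<nu> \<rho>} NSet a e {memory I \<sigma> x (\<nu>(a \<mapsto> y)) \<rho>}"
  by (rule hoare_NAssign) (use assms in \<open>auto simp: memory_def ram_output_def upd_apply upd_row\<close>)

lemma memory_update_real_var:
  assumes "memory I \<sigma> x \<nu> \<rho> s" "1 < a"
  shows "memory I \<sigma> x \<nu> (\<rho>(a \<mapsto> y)) (fst s, upd (snd s) a 0 y)"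
  using assms by (auto simp: memory_def ram_output_def upd_apply upd_row)

lemma memory_RSet:
  assumes "1 < a" "\<And>s. memory I \<sigma> x \<nu> \<rho> s \<Longrightarrow> rval e s = y"
  shows "\<turnstile>\<^bsub>1\<^esub> {memory I \<sigma> x \<nu> \<rho>} RSet a e {memory I \<sigma> x \<nu> (\<rho>(a \<mapsto> y))}"
  using assms by (intro hoare_RAssign) (simp add: memory_update_real_var)

lemma memory_RSet_If:
  assumes "1 < a" "\<rho> a = Some z"
    and "\<And>s. memory I \<sigma> x \<nu> \<rho> s \<Longrightarrow> bval b s \<longleftrightarrow> B"
    and "\<And>s. memory I \<sigma> x \<nu> \<rho> s \<Longrightarrow> rval e s = y"
  shows "\<turnstile>\<^bsub>1 + 1\<^esub> {memory I \<sigma> x \<nu> \<rho>} Cond b (RSet a e) Skip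
    {memory I \<sigma> x \<nu> (\<rho>(a \<mapsto> if B then y else z))}"
proof (rule hoare_Cond)
  show "\<turnstile>\<^bsub>1\<^esub> {\<lambda>s. memory I \<sigma> x \<nu> \<rho> s \<and> bval b s} RSet a e
      {memory I \<sigma> x \<nu> (\<rho>(a \<mapsto> if B then y else z))}"
    using assms by (intro hoare_RAssign) (auto simp: memory_update_real_var)
  show "\<turnstile>\<^bsub>1\<^esub> {\<lambda>s. memory I \<sigma> x \<nu> \<rho> s \<and> \<not> bval b s} Skip
      {memory I \<sigma> x \<nu> (\<rho>(a \<mapsto> if B then y else z))}"
    using assms by (intro hoare_Skip) (auto simp: map_upd_triv)
qed

lemma memory_write:
  assumes "j < num_weights I"
    and "\<And>s. memory I \<sigma> x \<nu> \<rho> s \<Longrightarrow> nval i s = v * num_weights I + j"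
    and "\<And>s. memory I \<sigma> x \<nu> \<rho> s \<Longrightarrow> rval e s = y"
  shows "\<turnstile>\<^bsub>1\<^esub> {memory I \<sigma> x \<nu> \<rho>} RAssign 1 i e {memory I \<sigma> (upd x v j y) \<nu> \<rho>}"
proof (rule hoare_RAssign)
  fix s assume s: "memory I \<sigma> x \<nu> \<rho> s"
  show "memory I \<sigma> (upd x v j y) \<nu> \<rho> (fst s, upd (snd s) 1 (nval i s) (rval e s))"
    using s row_major_eq_iff[OF _ assms(1)]
    by (auto simp: assms(2,3)[OF s] memory_def ram_output_def upd_apply upd_row)
qed

lemma memory_For:
  assumes counter: "3 < a" "\<nu> n a = None"
    and bound: "\<And>i s. i \<le> n \<Longrightarrow> memory I \<sigma> (x i) ((\<nu> i)(a \<mapsto> i)) (\<rho> i) s \<Longrightarrow> nval e s = n"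
    and body: "\<And>i. i < n \<Longrightarrow> \<turnstile>\<^bsub>t\<^esub> {memory I \<sigma> (x i) ((\<nu> i)(a \<mapsto> i)) (\<rho> i)} c
      {memory I \<sigma> (x (Suc i)) ((\<nu> (Suc i))(a \<mapsto> i)) (\<rho> (Suc i))}"
  shows "\<turnstile>\<^bsub>n * (t + 2) + 2\<^esub> {memory I \<sigma> (x 0) (\<nu> 0) (\<rho> 0)} For a e c
    {memory I \<sigma> (x n) (\<nu> n) (\<rho> n)}"
proof -
  let ?P = "\<lambda>i. memory I \<sigma> (x i) ((\<nu> i)(a \<mapsto> i)) (\<rho> i)"
  have body_Suc: "\<turnstile>\<^bsub>t + 1\<^esub> {?P i} c ;; NSet a (NAdd (NVar a) (NConst 1)) {?P (Suc i)}"
    if "i < n" for i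
  proof -
    note body[OF that]
    also have "\<turnstile>\<^bsub>1\<^esub> {memory I \<sigma> (x (Suc i)) ((\<nu> (Suc i))(a \<mapsto> i)) (\<rho> (Suc i))}
        NSet a (NAdd (NVar a) (NConst 1))
        {memory I \<sigma> (x (Suc i)) ((\<nu> (Suc i))(a \<mapsto> i, a \<mapsto> Suc i)) (\<rho> (Suc i))}"
      using counter(1) by (intro memory_NSet) (simp_all add: memory_def)
    finally show ?thesis
      by simp
  qed
  have guard: "bval (NLess (NVar a) e) s \<longleftrightarrow> i < n" if "i \<le> n" "?P i s" for i s
    using bound[OF that] that(2) by (simp add: memory_def)
  have loop: "\<turnstile>\<^bsub>(n - 0) * ((t + 1) + 1) + 1\<^esub> {?P 0}
      While (NLess (NVar a) e) (c ;; NSet a (NAdd (NVar a) (NConst 1))) {?P n}"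
    by (rule hoare_While_from[where P = ?P, OF guard body_Suc le0])
  have "\<turnstile>\<^bsub>1\<^esub> {memory I \<sigma> (x 0) (\<nu> 0) (\<rho> 0)} NSet a (NConst 0) {?P 0}"
    using counter(1) by (intro memory_NSet) simp_all
  from hoare_Seq[OF this loop] show ?thesis
    unfolding For_def by (rule memory_conseq) (use counter(2) in \<open>auto simp: map_le_def\<close>)
qed

section \<open>The program\<close>

abbreviation (input) time_var :: nat where "time_var \<equiv> 4"
abbreviation (input) class_var :: nat where "class_var \<equiv> 5"
abbreviation (input) point_var :: nat where "point_var \<equiv> 6"
abbreviation (input) address_var :: nat where "address_var \<equiv> 7"
abbreviation (input) counter_var :: nat where "counter_var \<equiv> 8"

abbreviation (input) level_var :: nat where "level_var \<equiv> 2"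
abbreviation (input) candidate_var :: nat where "candidate_var \<equiv> 3"
abbreviation (input) raised_var :: nat where "raised_var \<equiv> 4"
abbreviation (input) mass_var :: nat where "mass_var \<equiv> 5"
abbreviation (input) factor_var :: nat where "factor_var \<equiv> 6"

abbreviation (input) num_points_exp :: nexp where "num_points_exp \<equiv> NCell 0 (NConst 0)"
abbreviation (input) num_weights_exp :: nexp where "num_weights_exp \<equiv> NCell 0 (NConst 1)"
abbreviation (input) num_requests_exp :: nexp where "num_requests_exp \<equiv> NCell 0 (NConst 2)"
abbreviation (input) request_exp :: nexp where "request_exp \<equiv> NCell 1 (NVar time_var)"
abbreviation (input) weight_exp :: rexp where "weight_exp \<equiv> RCell 0 (NVar class_var)"
abbreviation (input) entry_exp :: rexp where "entry_exp \<equiv> RCell 1 (NVar address_var)"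
abbreviation (input) set_entry :: "rexp \<Rightarrow> com" where "set_entry \<equiv> RAssign 1 (NVar address_var)"

text \<open>Indices cannot be multiplied, so the row offset is obtained by repeated addition.\<close>

definition locate :: "nexp \<Rightarrow> com" where
  "locate e =
     NSet address_var (NVar class_var) ;;
     For counter_var e (NSet address_var (NAdd (NVar address_var) num_weights_exp))"

lemma locate_correct:
  assumes v: "v < num_points I" and e: "\<And>s. memory I \<sigma> x \<nu> \<rho> s \<Longrightarrow> nval e s = v"
    and bindings: "\<nu> class_var = Some j" "\<nu> address_var = None" "\<nu> counter_var = None"
  shows "\<turnstile>\<^bsub>3 * num_points I\<^esub> {memory I \<sigma> x \<nu> \<rho>} locate e
    {memory I \<sigma> x (\<nu>(address_var \<mapsto> v * num_weights I + j)) \<rho>}"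
proof -
  let ?\<nu> = "\<lambda>i. \<nu>(address_var \<mapsto> i * num_weights I + j)"
  have "\<turnstile>\<^bsub>1\<^esub> {memory I \<sigma> x \<nu> \<rho>} NSet address_var (NVar class_var) {memory I \<sigma> x (?\<nu> 0) \<rho>}"
    using memory_nat_var[where \<nu> = \<nu>, OF _ bindings(1)] by (intro memory_NSet) auto
  also have "\<turnstile>\<^bsub>v * (1 + 2) + 2\<^esub> {\<dots>}
      For counter_var e (NSet address_var (NAdd (NVar address_var) num_weights_exp))
      {memory I \<sigma> x (?\<nu> v) \<rho>}"
  proof (rule memory_For[where x = "\<lambda>_. x" and \<nu> = ?\<nu> and \<rho> = "\<lambda>_. \<rho>"])
    fix i s assume "memory I \<sigma> x ((?\<nu> i)(counter_var \<mapsto> i)) \<rho> s"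
    then have "memory I \<sigma> x \<nu> \<rho> s"
      by (rule memory_mono) (use bindings in \<open>auto simp: map_le_def\<close>)
    then show "nval e s = v"
      by (rule e)
  next
    fix i
    have "\<turnstile>\<^bsub>1\<^esub> {memory I \<sigma> x ((?\<nu> i)(counter_var \<mapsto> i)) \<rho>}
        NSet address_var (NAdd (NVar address_var) num_weights_exp)
        {memory I \<sigma> x ((?\<nu> i)(counter_var \<mapsto> i, address_var \<mapsto> Suc i * num_weights I + j)) \<rho>}"
      by (rule memory_NSet) (auto simp: memory_simps)
    then show "\<turnstile>\<^bsub>1\<^esub> {memory I \<sigma> x ((?\<nu> i)(counter_var \<mapsto> i)) \<rho>}
        NSet address_var (NAdd (NVar address_var) num_weights_exp)
        {memory I \<sigma> x ((?\<nu> (Suc i))(counter_var \<mapsto> i)) \<rho>}"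
      by (simp add: fun_upd_twist)
  qed (use bindings in auto)
  finally show ?thesis
    unfolding locate_def by (rule memory_conseq) (use v in simp_all)
qed

definition update_class ::
    "(nat \<Rightarrow> nat \<Rightarrow> real) \<Rightarrow> nat \<Rightarrow> (nat \<Rightarrow> real) \<Rightarrow> nat \<Rightarrow> nat \<Rightarrow> real" where
  "update_class x j c v i = (if i = j then c v else x v i)"

definition copy_program :: com where
  "copy_program = locate (NVar point_var) ;; set_entry (RNat (NCell 3 (NVar address_var)))"

definition load_program :: com where
  "load_program = For point_var num_points_exp (For class_var num_weights_exp copy_program)"

definition candidate_program :: com where
  "candidate_program =
     locate request_exp ;; RSet candidate_var (RMul weight_exp (RSub (RConst 1) entry_exp))"

definition lower_level_program :: com where
  "lower_level_program =
     candidate_program ;;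
     Cond (RLess (RVar candidate_var) (RVar level_var)) (RSet level_var (RVar candidate_var)) Skip"

definition level_program :: com where
  "level_program =
     NSet class_var (NConst 0) ;; candidate_program ;; RSet level_var (RVar candidate_var) ;;
     For class_var num_weights_exp lower_level_program ;;
     Cond (RLess (RVar level_var) (RConst 0)) (RSet level_var (RConst 0)) Skip"

definition sum_program :: com where
  "sum_program =
     For point_var num_points_exp
       (locate (NVar point_var) ;; RSet mass_var (RAdd (RVar mass_var) entry_exp))"

definition rescale_program :: com where
  "rescale_program =
     For point_var num_points_exp
       (locate (NVar point_var) ;; set_entry (RMul entry_exp (RVar factor_var)))"

text \<open>The sum starts at minus the entry of the request, so that it ends as the mass of the class
  at the other points.\<close>

definition measure_program :: com where
  "measure_program =
     locate request_exp ;;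
     RSet raised_var (RAdd entry_exp (RDiv (RVar level_var) weight_exp)) ;;
     RSet mass_var (RSub (RConst 0) entry_exp) ;;
     sum_program"

definition room_exp :: rexp where
  "room_exp =
     RSub (RMul (RMul (RConst 2) (RNat num_weights_exp)) (RNat (NCell 2 (NVar class_var))))
       (RVar raised_var)"

definition evict_program :: com where
  "evict_program =
     RSet factor_var (RConst 1) ;;
     Cond (RLess room_exp (RVar mass_var))
       (RSet factor_var (RDiv room_exp (RVar mass_var))) Skip ;;
     rescale_program ;;
     locate request_exp ;; set_entry (RVar raised_var)"

definition serve_program :: com where
  "serve_program =
     level_program ;; For class_var num_weights_exp (measure_program ;; evict_program)"

definition main_program :: com where
  "main_program = load_program ;; For time_var num_requests_exp serve_program"

lemma memory_initial_entry:
  assumes "memory I \<sigma> x \<nu> \<rho> s" "v < num_points I" "j < num_weights I"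
  shows "fst s 3 (v * num_weights I + j) = init I v j"
  using assms row_major_less[OF assms(2,3)] by (simp add: memory_simps)

lemma copy_program_correct:
  assumes v: "v < num_points I" and j: "j < num_weights I"
  shows "\<turnstile>\<^bsub>3 * num_points I + 1\<^esub>
    {memory I \<sigma> x [point_var \<mapsto> v, class_var \<mapsto> j] Map.empty}
    copy_program
    {memory I \<sigma> (upd x v j (real (init I v j))) [point_var \<mapsto> v, class_var \<mapsto> j] Map.empty}"
proof -
  let ?\<nu> = "[point_var \<mapsto> v, class_var \<mapsto> j]"
  let ?\<nu>' = "?\<nu>(address_var \<mapsto> v * num_weights I + j)"
  have "\<turnstile>\<^bsub>3 * num_points I\<^esub> {memory I \<sigma> x ?\<nu> Map.empty} locate (NVar point_var)
      {memory I \<sigma> x ?\<nu>' Map.empty}"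
    using v by (intro locate_correct) (simp_all add: memory_def)
  also have "\<turnstile>\<^bsub>1\<^esub> {\<dots>} set_entry (RNat (NCell 3 (NVar address_var)))
      {memory I \<sigma> (upd x v j (real (init I v j))) ?\<nu>' Map.empty}"
    using memory_initial_entry[OF _ v j] j by (intro memory_write) (simp_all add: memory_nat_var)
  finally show ?thesis
    unfolding copy_program_def by (rule memory_conseq) (simp_all add: map_le_def)
qed

lemma copy_row_correct:
  assumes v: "v < num_points I"
  shows "\<turnstile>\<^bsub>num_weights I * (3 * num_points I + 3) + 2\<^esub>
    {memory I \<sigma> x [point_var \<mapsto> v] Map.empty} For class_var num_weights_exp copy_program
    {memory I \<sigma> (x(v := \<lambda>j. real (init I v j))) [point_var \<mapsto> v] Map.empty}"
proof -
  define y where "y k = x(v := \<lambda>j. if j < k then real (init I v j) else x v j)" for k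
  have y_0: "y 0 = x" and y_Suc: "y (Suc k) = upd (y k) v k (real (init I v k))" for k
    by (auto simp: y_def upd_def less_Suc_eq fun_eq_iff)
  have "\<turnstile>\<^bsub>num_weights I * (3 * num_points I + 1 + 2) + 2\<^esub>
      {memory I \<sigma> (y 0) [point_var \<mapsto> v] Map.empty} For class_var num_weights_exp copy_program
      {memory I \<sigma> (y (num_weights I)) [point_var \<mapsto> v] Map.empty}"
    by (rule memory_For[where x = y and \<nu> = "\<lambda>_. [point_var \<mapsto> v]" and \<rho> = "\<lambda>_. Map.empty"])
      (use copy_program_correct[OF v] in \<open>simp_all add: memory_simps y_Suc\<close>)
  then show ?thesis
    unfolding y_0 by (rule memory_conseq) (simp_all add: y_def algebra_simps)
qed

lemma load_program_correct:
  "\<turnstile>\<^bsub>num_points I * (num_weights I * (3 * num_points I + 3) + 4) + 2\<^esub>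
    {memory I \<sigma> x Map.empty Map.empty} load_program
    {memory I \<sigma> (\<lambda>v j. real (init I v j)) Map.empty Map.empty}"
proof -
  let ?n = "num_points I"
  define y where "y u = (\<lambda>v. if v < u then \<lambda>j. real (init I v j) else x v)" for u
  have y_0: "y 0 = x" and y_Suc: "y (Suc u) = (y u)(u := \<lambda>j. real (init I u j))" for u
    by (auto simp: y_def less_Suc_eq)
  have "\<turnstile>\<^bsub>?n * (num_weights I * (3 * ?n + 3) + 2 + 2) + 2\<^esub>
      {memory I \<sigma> (y 0) Map.empty Map.empty} load_program {memory I \<sigma> (y ?n) Map.empty Map.empty}"
    unfolding load_program_def
    by (rule memory_For[where x = y and \<nu> = "\<lambda>_. Map.empty" and \<rho> = "\<lambda>_. Map.empty"])
      (use copy_row_correct in \<open>simp_all add: memory_simps y_Suc\<close>)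
  then show ?thesis
    unfolding y_0 by (rule memory_conseq) (simp_all add: y_def algebra_simps)
qed

context
  fixes I :: server_instance and \<sigma> :: "nat list" and t :: nat
  assumes valid: "valid_instance I" and requests: "valid_requests I \<sigma>" and t: "t < length \<sigma>"
begin

lemma request_less: "\<sigma> ! t < num_points I"
  using requests t by (rule valid_requests_nth)

lemma locate_request_correct:
  "\<turnstile>\<^bsub>3 * num_points I\<^esub> {memory I \<sigma> x [time_var \<mapsto> t, class_var \<mapsto> j] \<rho>} locate request_exp
    {memory I \<sigma> x
      [time_var \<mapsto> t, class_var \<mapsto> j, address_var \<mapsto> \<sigma> ! t * num_weights I + j] \<rho>}"
  using t request_less by (intro locate_correct) (simp_all add: memory_simps)

lemma locate_point_correct:
  assumes "v < num_points I"
  shows "\<turnstile>\<^bsub>3 * num_points I\<^esub>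
    {memory I \<sigma> x [time_var \<mapsto> t, class_var \<mapsto> j, point_var \<mapsto> v] \<rho>} locate (NVar point_var)
    {memory I \<sigma> x [time_var \<mapsto> t, class_var \<mapsto> j, point_var \<mapsto> v,
      address_var \<mapsto> v * num_weights I + j] \<rho>}"
  using assms by (intro locate_correct) (simp_all add: memory_def)

lemma candidate_program_correct:
  assumes j: "j < num_weights I"
  shows "\<turnstile>\<^bsub>3 * num_points I + 1\<^esub> {memory I \<sigma> x [time_var \<mapsto> t, class_var \<mapsto> j] \<rho>}
    candidate_program
    {memory I \<sigma> x [time_var \<mapsto> t, class_var \<mapsto> j]
      (\<rho>(candidate_var \<mapsto> weight I j * (1 - x (\<sigma> ! t) j)))}"
proof -
  note locate_request_correct
  also have "\<turnstile>\<^bsub>1\<^esub> {memory I \<sigma> x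
        [time_var \<mapsto> t, class_var \<mapsto> j, address_var \<mapsto> \<sigma> ! t * num_weights I + j] \<rho>}
      RSet candidate_var (RMul weight_exp (RSub (RConst 1) entry_exp))
      {memory I \<sigma> x [time_var \<mapsto> t, class_var \<mapsto> j, address_var \<mapsto> \<sigma> ! t * num_weights I + j]
        (\<rho>(candidate_var \<mapsto> weight I j * (1 - x (\<sigma> ! t) j)))}"
    using j request_less by (intro memory_RSet) (simp_all add: memory_simps)
  finally show ?thesis
    unfolding candidate_program_def by (rule memory_conseq) (simp_all add: map_le_def)
qed

lemma lower_level_program_correct:
  assumes j: "j < num_weights I"
  shows "\<turnstile>\<^bsub>3 * num_points I + 3\<^esub>
    {memory I \<sigma> x [time_var \<mapsto> t, class_var \<mapsto> j] [level_var \<mapsto> s]} lower_level_program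
    {memory I \<sigma> x [time_var \<mapsto> t, class_var \<mapsto> j]
      [level_var \<mapsto> min s (weight I j * (1 - x (\<sigma> ! t) j))]}"
proof -
  let ?g = "weight I j * (1 - x (\<sigma> ! t) j)"
  note candidate_program_correct[OF j]
  also have "\<turnstile>\<^bsub>1 + 1\<^esub> {memory I \<sigma> x [time_var \<mapsto> t, class_var \<mapsto> j]
        [level_var \<mapsto> s, candidate_var \<mapsto> ?g]}
      Cond (RLess (RVar candidate_var) (RVar level_var)) (RSet level_var (RVar candidate_var)) Skip
      {memory I \<sigma> x [time_var \<mapsto> t, class_var \<mapsto> j]
        [level_var \<mapsto> s, candidate_var \<mapsto> ?g, level_var \<mapsto> if ?g < s then ?g else s]}"
    by (rule memory_RSet_If) (simp_all add: memory_simps)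
  finally show ?thesis
    unfolding lower_level_program_def by (rule memory_conseq) (simp_all add: map_le_def min_def)
qed

lemma level_program_correct:
  "\<turnstile>\<^bsub>num_weights I * (3 * num_points I + 5) + 3 * num_points I + 7\<^esub>
    {memory I \<sigma> x [time_var \<mapsto> t] Map.empty} level_program
    {memory I \<sigma> x [time_var \<mapsto> t] [level_var \<mapsto> raise_level I x (\<sigma> ! t)]}"
proof -
  define g where "g j = weight I j * (1 - x (\<sigma> ! t) j)" for j
  define least where "least k = Min (g ` insert 0 {..<k})" for k
  note first_class = num_weights_pos[OF valid]
  have least_Suc: "least (Suc k) = min (least k) (g k)" for k
    unfolding least_def
    by (subst min.commute, subst Min_insert[symmetric]) (auto simp: lessThan_Suc insert_commute)
  have level: "raise_level I x (\<sigma> ! t) = max 0 (least (num_weights I))"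
    using first_class by (simp add: raise_level_def least_def g_def insert_absorb)
  have "\<turnstile>\<^bsub>1\<^esub> {memory I \<sigma> x [time_var \<mapsto> t] Map.empty} NSet class_var (NConst 0)
      {memory I \<sigma> x [time_var \<mapsto> t, class_var \<mapsto> 0] Map.empty}"
    by (rule memory_NSet) simp_all
  also note candidate_program_correct[OF first_class, of x, folded g_def]
  also have "\<turnstile>\<^bsub>1\<^esub> {memory I \<sigma> x [time_var \<mapsto> t, class_var \<mapsto> 0] [candidate_var \<mapsto> g 0]}
      RSet level_var (RVar candidate_var) {memory I \<sigma> x [time_var \<mapsto> t] [level_var \<mapsto> least 0]}"
    by (rule memory_conseq[OF memory_RSet[where y = "g 0"]])
      (simp_all add: memory_simps map_le_def least_def)
  also have "\<turnstile>\<^bsub>num_weights I * (3 * num_points I + 3 + 2) + 2\<^esub> {\<dots>}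
      For class_var num_weights_exp lower_level_program
      {memory I \<sigma> x [time_var \<mapsto> t] [level_var \<mapsto> least (num_weights I)]}"
    by (rule memory_For[where x = "\<lambda>_. x" and \<nu> = "\<lambda>_. [time_var \<mapsto> t]"
          and \<rho> = "\<lambda>k. [level_var \<mapsto> least k]"])
      (use lower_level_program_correct in \<open>simp_all add: memory_simps least_Suc g_def\<close>)
  also have "\<turnstile>\<^bsub>1 + 1\<^esub> {\<dots>}
      Cond (RLess (RVar level_var) (RConst 0)) (RSet level_var (RConst 0)) Skip
      {memory I \<sigma> x [time_var \<mapsto> t] [level_var \<mapsto> raise_level I x (\<sigma> ! t)]}"
    by (rule memory_conseq[OF memory_RSet_If[where B = "least (num_weights I) < 0" and y = 0]])
      (auto simp: memory_simps level)
  finally show ?thesis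
    unfolding level_program_def by (rule memory_conseq) (simp_all add: algebra_simps)
qed

lemma sum_program_correct:
  assumes j: "j < num_weights I"
  shows "\<turnstile>\<^bsub>num_points I * (3 * num_points I + 3) + 2\<^esub>
    {memory I \<sigma> x [time_var \<mapsto> t, class_var \<mapsto> j] (\<rho>(mass_var \<mapsto> m))} sum_program
    {memory I \<sigma> x [time_var \<mapsto> t, class_var \<mapsto> j]
      (\<rho>(mass_var \<mapsto> m + (\<Sum>v<num_points I. x v j)))}"
proof -
  let ?n = "num_points I" and ?\<nu> = "[time_var \<mapsto> t, class_var \<mapsto> j]"
  let ?\<rho> = "\<lambda>v. \<rho>(mass_var \<mapsto> m + (\<Sum>u<v. x u j))"
  have add: "\<turnstile>\<^bsub>3 * ?n + 1\<^esub> {memory I \<sigma> x (?\<nu>(point_var \<mapsto> v)) (?\<rho> v)}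
      locate (NVar point_var) ;; RSet mass_var (RAdd (RVar mass_var) entry_exp)
      {memory I \<sigma> x (?\<nu>(point_var \<mapsto> v)) (?\<rho> (Suc v))}" if v: "v < ?n" for v
  proof -
    let ?\<nu>' = "?\<nu>(point_var \<mapsto> v, address_var \<mapsto> v * num_weights I + j)"
    note locate_point_correct[OF v]
    also have "\<turnstile>\<^bsub>1\<^esub> {memory I \<sigma> x ?\<nu>' (?\<rho> v)}
        RSet mass_var (RAdd (RVar mass_var) entry_exp)
        {memory I \<sigma> x ?\<nu>' ((?\<rho> v)(mass_var \<mapsto> m + (\<Sum>u<Suc v. x u j)))}"
      using v j by (intro memory_RSet) (simp_all add: memory_simps)
    finally show ?thesis
      by (rule memory_conseq) (simp_all add: map_le_def)
  qed
  have "\<turnstile>\<^bsub>?n * (3 * ?n + 1 + 2) + 2\<^esub> {memory I \<sigma> x ?\<nu> (?\<rho> 0)} sum_program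
      {memory I \<sigma> x ?\<nu> (?\<rho> ?n)}"
    unfolding sum_program_def
    by (rule memory_For[where x = "\<lambda>_. x" and \<nu> = "\<lambda>_. ?\<nu>" and \<rho> = ?\<rho>])
      (rule add | simp add: memory_simps)+
  then show ?thesis
    by (rule hoare_conseq) (simp_all add: algebra_simps)
qed

lemma rescale_program_correct:
  assumes j: "j < num_weights I"
  shows "\<turnstile>\<^bsub>num_points I * (3 * num_points I + 3) + 2\<^esub>
    {memory I \<sigma> x [time_var \<mapsto> t, class_var \<mapsto> j] (\<rho>(factor_var \<mapsto> f))} rescale_program
    {memory I \<sigma> (update_class x j (\<lambda>v. x v j * f)) [time_var \<mapsto> t, class_var \<mapsto> j]
      (\<rho>(factor_var \<mapsto> f))}"
proof -
  let ?n = "num_points I" and ?\<nu> = "[time_var \<mapsto> t, class_var \<mapsto> j]"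
  let ?\<rho> = "\<rho>(factor_var \<mapsto> f)"
  define y where "y u = update_class x j (\<lambda>v. if v < u then x v j * f else x v j)" for u
  have y_0: "y 0 = x" and y_Suc: "y (Suc v) = upd (y v) v j (y v v j * f)" for v
    by (auto simp: y_def update_class_def upd_apply less_Suc_eq fun_eq_iff)
  have scale: "\<turnstile>\<^bsub>3 * ?n + 1\<^esub> {memory I \<sigma> (y v) (?\<nu>(point_var \<mapsto> v)) ?\<rho>}
      locate (NVar point_var) ;; set_entry (RMul entry_exp (RVar factor_var))
      {memory I \<sigma> (y (Suc v)) (?\<nu>(point_var \<mapsto> v)) ?\<rho>}" if v: "v < ?n" for v
  proof -
    let ?\<nu>' = "?\<nu>(point_var \<mapsto> v, address_var \<mapsto> v * num_weights I + j)"
    note locate_point_correct[OF v]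
    also have "\<turnstile>\<^bsub>1\<^esub> {memory I \<sigma> (y v) ?\<nu>' ?\<rho>} set_entry (RMul entry_exp (RVar factor_var))
        {memory I \<sigma> (y (Suc v)) ?\<nu>' ?\<rho>}"
      unfolding y_Suc using v j by (intro memory_write) (simp_all add: memory_simps)
    finally show ?thesis
      by (rule memory_conseq) (simp_all add: map_le_def)
  qed
  have "\<turnstile>\<^bsub>?n * (3 * ?n + 1 + 2) + 2\<^esub> {memory I \<sigma> (y 0) ?\<nu> ?\<rho>} rescale_program
      {memory I \<sigma> (y ?n) ?\<nu> ?\<rho>}"
    unfolding rescale_program_def
    by (rule memory_For[where x = y and \<nu> = "\<lambda>_. ?\<nu>" and \<rho> = "\<lambda>_. ?\<rho>"])
      (rule scale | simp add: memory_simps)+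
  then show ?thesis
    unfolding y_0
    by (rule memory_conseq) (simp_all add: y_def update_class_def algebra_simps)
qed

lemma measure_program_correct:
  assumes j: "j < num_weights I"
  shows "\<turnstile>\<^bsub>num_points I * (3 * num_points I + 6) + 4\<^esub>
    {memory I \<sigma> x [time_var \<mapsto> t, class_var \<mapsto> j] [level_var \<mapsto> s]} measure_program
    {memory I \<sigma> x [time_var \<mapsto> t, class_var \<mapsto> j]
      [level_var \<mapsto> s, raised_var \<mapsto> x (\<sigma> ! t) j + s / weight I j,
       mass_var \<mapsto> \<Sum>v\<in>{..<num_points I} - {\<sigma> ! t}. x v j]}"
proof -
  let ?r = "\<sigma> ! t" and ?\<nu> = "[time_var \<mapsto> t, class_var \<mapsto> j]"
  let ?\<nu>' = "?\<nu>(address_var \<mapsto> ?r * num_weights I + j)"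
  let ?z = "x ?r j + s / weight I j"
  have sum: "- x ?r j + (\<Sum>v<num_points I. x v j) = (\<Sum>v\<in>{..<num_points I} - {?r}. x v j)"
    using request_less by (simp add: sum.remove)
  note locate_request_correct
  also have "\<turnstile>\<^bsub>1\<^esub> {memory I \<sigma> x ?\<nu>' [level_var \<mapsto> s]}
      RSet raised_var (RAdd entry_exp (RDiv (RVar level_var) weight_exp))
      {memory I \<sigma> x ?\<nu>' [level_var \<mapsto> s, raised_var \<mapsto> ?z]}"
    using j request_less by (intro memory_RSet) (simp_all add: memory_simps)
  also have "\<turnstile>\<^bsub>1\<^esub> {\<dots>} RSet mass_var (RSub (RConst 0) entry_exp)
      {memory I \<sigma> x ?\<nu> [level_var \<mapsto> s, raised_var \<mapsto> ?z, mass_var \<mapsto> - x ?r j]}"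
    using j request_less
    by (intro memory_conseq[OF memory_RSet]) (auto simp: memory_simps map_le_def)
  also note sum_program_correct[OF j]
  also note sum
  finally show ?thesis
    unfolding measure_program_def by (rule memory_conseq) (simp_all add: map_le_def algebra_simps)
qed

lemma evict_program_correct:
  assumes j: "j < num_weights I" and z: "z = x (\<sigma> ! t) j + s / weight I j"
    and M: "M = (\<Sum>v\<in>{..<num_points I} - {\<sigma> ! t}. x v j)"
  shows "\<turnstile>\<^bsub>num_points I * (3 * num_points I + 6) + 6\<^esub>
    {memory I \<sigma> x [time_var \<mapsto> t, class_var \<mapsto> j]
      [level_var \<mapsto> s, raised_var \<mapsto> z, mass_var \<mapsto> M]}
    evict_program
    {memory I \<sigma> (update_class x j
        (deposit {..<num_points I} (real (augmented_servers I j)) (\<sigma> ! t) (s / weight I j)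
          (\<lambda>v. x v j)))
      [time_var \<mapsto> t, class_var \<mapsto> j] [level_var \<mapsto> s]}"
proof -
  let ?r = "\<sigma> ! t" and ?\<nu> = "[time_var \<mapsto> t, class_var \<mapsto> j]"
  let ?\<rho> = "[level_var \<mapsto> s, raised_var \<mapsto> z, mass_var \<mapsto> M]"
  define room where "room = real (augmented_servers I j) - z"
  define f where "f = shrink_factor room M"
  let ?\<nu>' = "?\<nu>(address_var \<mapsto> ?r * num_weights I + j)"
  define y where "y = update_class x j (\<lambda>v. x v j * f)"
  have "\<turnstile>\<^bsub>1\<^esub> {memory I \<sigma> x ?\<nu> ?\<rho>} RSet factor_var (RConst 1)
      {memory I \<sigma> x ?\<nu> (?\<rho>(factor_var \<mapsto> 1))}"
    by (rule memory_RSet) simp_all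
  also have "\<turnstile>\<^bsub>1 + 1\<^esub> {\<dots>} Cond (RLess room_exp (RVar mass_var))
      (RSet factor_var (RDiv room_exp (RVar mass_var))) Skip
      {memory I \<sigma> x ?\<nu> (?\<rho>(factor_var \<mapsto> 1, factor_var \<mapsto> if room < M then room / M else 1))}"
    using j by (intro memory_RSet_If)
      (simp_all add: memory_simps room_exp_def room_def augmented_servers_def)
  also have "?\<rho>(factor_var \<mapsto> 1, factor_var \<mapsto> if room < M then room / M else 1)
      = ?\<rho>(factor_var \<mapsto> f)"
    by (simp add: f_def shrink_factor_def)
  also note rescale_program_correct[OF j, of x _ f, folded y_def]
  also note locate_request_correct
  also have "\<turnstile>\<^bsub>1\<^esub> {memory I \<sigma> y ?\<nu>' (?\<rho>(factor_var \<mapsto> f))} set_entry (RVar raised_var)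
      {memory I \<sigma> (upd y ?r j z) ?\<nu>' (?\<rho>(factor_var \<mapsto> f))}"
    using j by (intro memory_write) (simp_all add: memory_simps)
  finally show ?thesis
    unfolding evict_program_def
    by (rule memory_conseq)
      (auto simp: map_le_def algebra_simps upd_apply update_class_def deposit_def
        y_def f_def room_def z M)
qed

lemma serve_program_correct:
  "\<turnstile>\<^bsub>num_weights I * (num_points I * (6 * num_points I + 15) + 17) + 3 * num_points I + 9\<^esub>
    {memory I \<sigma> x [time_var \<mapsto> t] Map.empty} serve_program
    {memory I \<sigma> (serve I x (\<sigma> ! t)) [time_var \<mapsto> t] Map.empty}"
proof -
  let ?n = "num_points I" and ?r = "\<sigma> ! t" and ?s = "raise_level I x (\<sigma> ! t)"
  define y where "y k = (\<lambda>v j. if j < k then serve I x ?r v j else x v j)" for k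
  let ?t = "?n * (3 * ?n + 6) + 4 + (?n * (3 * ?n + 6) + 6)"
  have update: "\<turnstile>\<^bsub>?t\<^esub>
      {memory I \<sigma> (y j) [time_var \<mapsto> t, class_var \<mapsto> j] [level_var \<mapsto> ?s]}
      measure_program ;; evict_program
      {memory I \<sigma> (y (Suc j)) [time_var \<mapsto> t, class_var \<mapsto> j] [level_var \<mapsto> ?s]}"
    if j: "j < num_weights I" for j
  proof -
    note measure_program_correct[OF j]
    also note evict_program_correct[OF j refl refl]
    finally show ?thesis
      by (rule memory_conseq) (auto simp: y_def update_class_def serve_def)
  qed
  have loop: "\<turnstile>\<^bsub>num_weights I * (?t + 2) + 2\<^esub> {memory I \<sigma> (y 0) [time_var \<mapsto> t] [level_var \<mapsto> ?s]}
      For class_var num_weights_exp (measure_program ;; evict_program)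
      {memory I \<sigma> (y (num_weights I)) [time_var \<mapsto> t] [level_var \<mapsto> ?s]}"
    by (rule memory_For[where x = y and \<nu> = "\<lambda>_. [time_var \<mapsto> t]"
          and \<rho> = "\<lambda>_. [level_var \<mapsto> ?s]"])
      (rule update | simp add: memory_simps)+
  have y_0: "y 0 = x"
    by (simp add: y_def)
  note level_program_correct
  also note loop[unfolded y_0]
  finally show ?thesis
    unfolding serve_program_def
    by (rule memory_conseq) (auto simp: y_def algebra_simps)
qed

end

lemma main_program_correct:
  assumes "valid_instance I" "valid_requests I \<sigma>"
  shows "\<turnstile>\<^bsub>num_points I * (num_weights I * (3 * num_points I + 3) + 4) +
      length \<sigma> * (num_weights I * (num_points I * (6 * num_points I + 15) + 17)
        + 3 * num_points I + 11) + 4\<^esub>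
    {memory I \<sigma> x Map.empty Map.empty} main_program
    {memory I \<sigma> (serve_all I \<sigma>) Map.empty Map.empty}"
proof -
  let ?t = "num_weights I * (num_points I * (6 * num_points I + 15) + 17) + 3 * num_points I + 9"
  have loop: "\<turnstile>\<^bsub>length \<sigma> * (?t + 2) + 2\<^esub>
      {memory I \<sigma> (serve_all I (take 0 \<sigma>)) Map.empty Map.empty}
      For time_var num_requests_exp serve_program
      {memory I \<sigma> (serve_all I (take (length \<sigma>) \<sigma>)) Map.empty Map.empty}"
  proof (rule memory_For[where x = "\<lambda>t. serve_all I (take t \<sigma>)" and \<nu> = "\<lambda>_. Map.empty"
        and \<rho> = "\<lambda>_. Map.empty"])
    fix t assume t: "t < length \<sigma>"
    show "\<turnstile>\<^bsub>?t\<^esub> {memory I \<sigma> (serve_all I (take t \<sigma>)) [time_var \<mapsto> t] Map.empty} serve_program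
        {memory I \<sigma> (serve_all I (take (Suc t) \<sigma>)) [time_var \<mapsto> t] Map.empty}"
      using serve_program_correct[OF assms t] by (simp add: serve_all_take_Suc[OF t])
  qed (simp_all add: memory_simps)
  note load_program_correct
  also note loop[unfolded take_0 serve_all_Nil]
  finally show ?thesis
    unfolding main_program_def by (rule memory_conseq) (simp_all add: algebra_simps)
qed

lemma memory_input_state:
  "memory I \<sigma> (ram_output I (input_state I \<sigma>)) Map.empty Map.empty (input_state I \<sigma>)"
  by (simp add: memory_def)

lemma polynomial_time_serve_all: "polynomial_time serve_all"
  unfolding polynomial_time_def
proof (rule exI[of _ main_program], rule exI[of _ 66], intro allI impI)
  fix I \<sigma> assume valid: "valid_instance I" and requests: "valid_requests I \<sigma>"
  let ?n = "num_points I" and ?l = "num_weights I" and ?T = "length \<sigma>"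
  define S where "S = ?n + ?l + ?T"
  have size_le: "?n \<le> S" "?l \<le> S" "?T \<le> S" "1 \<le> S"
    using num_weights_pos[OF valid] by (auto simp: S_def)
  obtain t s where run: "runs main_program (input_state I \<sigma>) t s"
    and steps: "t \<le> ?n * (?l * (3 * ?n + 3) + 4)
      + ?T * (?l * (?n * (6 * ?n + 15) + 17) + 3 * ?n + 11) + 4"
    and final: "memory I \<sigma> (serve_all I \<sigma>) Map.empty Map.empty s"
    using hoareE[OF main_program_correct[OF valid requests] memory_input_state] .
  note steps
  also have "?n * (?l * (3 * ?n + 3) + 4) + ?T * (?l * (?n * (6 * ?n + 15) + 17) + 3 * ?n + 11) + 4
      \<le> S * (S * (3 * S + 3) + 4) + S * (S * (S * (6 * S + 15) + 17) + 3 * S + 11) + 4"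
    using size_le by (intro add_mono mult_le_mono order_refl)
  also have "\<dots> = 6 * S ^ 4 + 18 * S ^ 3 + 23 * S ^ 2 + 15 * S ^ 1 + 4 * S ^ 0"
    by (simp add: eval_nat_numeral algebra_simps)
  also have "\<dots> \<le> 6 * S ^ 66 + 18 * S ^ 66 + 23 * S ^ 66 + 15 * S ^ 66 + 4 * S ^ 66"
    using size_le(4) by (intro add_mono mult_le_mono order_refl power_increasing) auto
  finally have "t \<le> 66 * (?n + ?l + ?T) ^ 66"
    by (simp add: S_def)
  then show "\<exists>t s. runs main_program (input_state I \<sigma>) t s \<and> t \<le> 66 * (?n + ?l + ?T) ^ 66 \<and>
      (\<forall>v<?n. \<forall>j<?l. serve_all I \<sigma> v j = ram_output I s v j)"
    using run final by (intro exI[of _ t] exI[of _ s]) (simp add: memory_def)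
qed

theorem theorem5p1:
  shows "\<exists>(A :: online_alg) (\<rho> :: nat \<Rightarrow> real).
    polynomial_time A \<and>
    \<rho> \<in> O(\<lambda>l. (real l)\<^sup>2 * ln (real l)) \<and>
    (\<forall>I \<sigma>. valid_instance I \<longrightarrow> valid_requests I \<sigma> \<longrightarrow>
       fractional_solution I (\<lambda>j. 2 * num_weights I * servers I j) (length \<sigma>) (trajectory A I \<sigma>) \<and>
       single_weight_service I \<sigma> (trajectory A I \<sigma>) \<and>
       movement_cost I (length \<sigma>) (trajectory A I \<sigma>) \<le> \<rho> (num_weights I) * lp_opt I \<sigma>)"
proof (intro exI[of _ serve_all] exI[of _ "\<lambda>l. 6 * real l"] conjI allI impI)
  show "polynomial_time serve_all"
    by (rule polynomial_time_serve_all)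
  show "(\<lambda>l. 6 * real l) \<in> O(\<lambda>l. (real l)\<^sup>2 * ln (real l))"
    by real_asymp
  fix I \<sigma> assume valid: "valid_instance I" and requests: "valid_requests I \<sigma>"
  show "fractional_solution I (\<lambda>j. 2 * num_weights I * servers I j) (length \<sigma>)
      (trajectory serve_all I \<sigma>)"
    using fractional_solution_serve_all[OF valid requests]
    by (simp add: augmented_servers_def[abs_def])
  show "single_weight_service I \<sigma> (trajectory serve_all I \<sigma>)"
    using valid by (rule single_weight_service_serve_all)
  show "movement_cost I (length \<sigma>) (trajectory serve_all I \<sigma>)
      \<le> 6 * real (num_weights I) * lp_opt I \<sigma>"
    using valid requests by (rule trajectory_competitive)
qed

end
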